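(* In $\pi_1(\mathbb{H}^+,b_0^+)$, we have $c_\tau\notin cl_{C,c_\infty}(C)$.
   Context: A map is a continuous function; $f_{\#}$ denotes the homomorphism induced on fundamental groups. For paths, $\alpha\cdot\beta$ is concatenation and $\alpha^{-}(t)=\alpha(1-t)$. Closed subgroups and closure: for a based space $(\mathbb{T},t_0)$, a subgroup $T\leq\pi_1(\mathbb{T},t_0)$ and $g\in\pi_1(\mathbb{T},t_0)$, a subgroup $H\leq\pi_1(X,x_0)$ of the fundamental group of a based space $(X,x_0)$ is $(T,g)$-closed if for every map $f:(\mathbb{T},t_0)\to(X,x_0)$ with $f_{\#}(T)\leq H$ we have $f_{\#}(g)\in H$. The $(T,g)$-closure $cl_{T,g}(H)$ is the intersection of all $(T,g)$-closed subgroups of $\pi_1(X,x_0)$ containing $H$. The space $\mathbb{H}^+$: let $C_n\subseteq\mathbb{R}^2$ be the circle of radius $\frac1n$ centered at $(\frac1n,0)$, $\mathbb{H}=\bigcup_{n\geq1}C_n$, $b_0=(0,0)$, and $\mathbb{H}^+=\mathbb{H}\cup([-1,0]\times\{0\})$ with basepoint $b_0^+=(-1,0)$. Let $\ell_n$ be the loop based at $b_0$ traversing $C_n$ once counterclockwise, and $\ell_\infty:[0,1]\to\mathbb{H}$ the loop that is $\ell_n$ (linearly reparametrized) on $[\frac{n-1}{n},\frac{n}{n+1}]$ for each $n\geq1$, with $\ell_\infty(1)=b_0$. Let $\mathcal{C}\subseteq[0,1]$ be the standard middle third Cantor set and write $[0,1]\setminus\mathcal{C}=\bigcup_{n\geq1}\bigcup_{k=1}^{2^{n-1}}I_n^k$,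 where $I_n^k$ are the components of length $\frac{1}{3^n}$, indexed by $k$ in their natural order. Let $\ell_\tau:[0,1]\to\mathbb{H}$ be the loop with $\ell_\tau(\mathcal{C})=\{b_0\}$ and equal to $\ell_{2^{n-1}+k-1}$ (linearly reparametrized) on $\overline{I_n^k}$. Let $\iota:[0,1]\to\mathbb{H}^+$, $\iota(t)=(t-1,0)$. Put $c_n=[\iota\cdot\ell_n\cdot\iota^{-}]$, $C=\langle c_n\mid n\in\mathbb{N}\rangle\leq\pi_1(\mathbb{H}^+,b_0^+)$, $c_\infty=[\iota\cdot\ell_\infty\cdot\iota^{-}]$, and $c_\tau=[\iota\cdot\ell_\tau\cdot\iota^{-}]$. *)

theory Defs
  imports "HOL-Analysis.Analysis" "HOL-Algebra.Generated_Groups"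
begin

section \<open>Fundamental groups\<close>

text \<open>A space is a subset \<open>S\<close> of some type of class \<open>topological_space\<close>, with the subspace topology.
  A path is a function on all of \<^typ>\<open>real\<close> of which only the values on \<open>{0..1}\<close> matter;
  \<^const>\<open>homotopic_paths\<close> (homotopy rel endpoints in \<open>S\<close>) ignores the other values.\<close>

definition based_loops :: "'a::topological_space set \<Rightarrow> 'a \<Rightarrow> (real \<Rightarrow> 'a) set" where
  "based_loops S x0 =
     {p. path p \<and> path_image p \<subseteq> S \<and> pathstart p = x0 \<and> pathfinish p = x0}"

definition path_class :: "'a::topological_space set \<Rightarrow> (real \<Rightarrow> 'a) \<Rightarrow> (real \<Rightarrow> 'a) set" where
  "path_class S p = {q. homotopic_paths S p q}"

definition fundamental_group ::
    "'a::topological_space set \<Rightarrow> 'a \<Rightarrow> (real \<Rightarrow> 'a) set monoid" where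
  "fundamental_group S x0 =
     \<lparr> carrier = path_class S ` based_loops S x0,
       mult = (\<lambda>A B. \<Union>p\<in>A. \<Union>q\<in>B. path_class S (p +++ q)),
       one = path_class S (\<lambda>_. x0) \<rparr>"

definition induced_hom ::
    "'b::topological_space set \<Rightarrow> ('a::topological_space \<Rightarrow> 'b) \<Rightarrow> (real \<Rightarrow> 'a) set \<Rightarrow> (real \<Rightarrow> 'b) set" where
  "induced_hom Y f A = (\<Union>p\<in>A. path_class Y (f \<circ> p))"

lemma path_class_eqI: "homotopic_paths S p q \<Longrightarrow> path_class S p = path_class S q"
  unfolding path_class_def using homotopic_paths_trans homotopic_paths_sym by blast

lemma path_class_self: "p \<in> based_loops S x0 \<Longrightarrow> p \<in> path_class S p"
  by (simp add: path_class_def based_loops_def)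

lemma path_class_eq_iff:
  assumes "p \<in> based_loops S x0"
  shows "path_class S q = path_class S p \<longleftrightarrow> homotopic_paths S q p"
  using path_class_eqI path_class_self[OF assms] by (auto simp: path_class_def)

lemma mult_path_class:
  assumes "p \<in> based_loops S x0" "q \<in> based_loops S x0"
  shows "path_class S p \<otimes>\<^bsub>fundamental_group S x0\<^esub> path_class S q = path_class S (p +++ q)"
proof -
  have "path_class S (p' +++ q') = path_class S (p +++ q)"
    if "p' \<in> path_class S p" "q' \<in> path_class S q" for p' q'
  proof -
    have "homotopic_paths S (p +++ q) (p' +++ q')"
      using that assms by (intro homotopic_paths_join) (auto simp: path_class_def based_loops_def)
    then show ?thesis using path_class_eqI by metis
  qed
  moreover have "p \<in> path_class S p" "q \<in> path_class S q"
    using assms path_class_self by auto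
  ultimately have "(\<Union>p'\<in>path_class S p. \<Union>q'\<in>path_class S q. path_class S (p' +++ q'))
      = path_class S (p +++ q)"
    by blast
  then show ?thesis
    by (simp add: fundamental_group_def)
qed

lemma induced_hom_path_class:
  assumes "continuous_on S f" "f \<in> S \<rightarrow> Y" "p \<in> based_loops S x0"
  shows "induced_hom Y f (path_class S p) = path_class Y (f \<circ> p)"
proof -
  have "path_class Y (f \<circ> p') = path_class Y (f \<circ> p)" if "p' \<in> path_class S p" for p'
    using that assms homotopic_paths_continuous_image path_class_eqI
    unfolding path_class_def by (metis mem_Collect_eq)
  then show ?thesis
    using path_class_self[OF assms(3)] unfolding induced_hom_def by blast
qed

lemma carrier_fundamental_group:
  "carrier (fundamental_group S x0) = path_class S ` based_loops S x0"
  by (simp add: fundamental_group_def)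

lemma one_fundamental_group: "\<one>\<^bsub>fundamental_group S x0\<^esub> = path_class S (\<lambda>_. x0)"
  by (simp add: fundamental_group_def)

lemma based_loops_join:
  "p \<in> based_loops S x0 \<Longrightarrow> q \<in> based_loops S x0 \<Longrightarrow> p +++ q \<in> based_loops S x0"
  by (auto simp: based_loops_def path_image_join)

lemma based_loops_reverse: "p \<in> based_loops S x0 \<Longrightarrow> reversepath p \<in> based_loops S x0"
  by (auto simp: based_loops_def)

lemma based_loops_const: "x0 \<in> S \<Longrightarrow> (\<lambda>_. x0) \<in> based_loops S x0"
  by (auto simp: based_loops_def path_def path_image_def pathstart_def pathfinish_def)

lemma homotopic_const_join:
  assumes "p \<in> based_loops S x0"
  shows "homotopic_paths S ((\<lambda>_. x0) +++ p) p"
proof (rule homotopic_paths_sym)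
  have "continuous_on {0..1} (\<lambda>t::real. max 0 (2 * t - 1))"
    by (intro continuous_intros)
  moreover have "((\<lambda>_. x0) +++ p) t = p (max 0 (2 * t - 1))" for t
    using assms by (cases "t \<le> 1 / 2") (auto simp: based_loops_def joinpaths_def pathstart_def)
  ultimately show "homotopic_paths S p ((\<lambda>_. x0) +++ p)"
    using assms
    by (intro homotopic_paths_reparametrize[where f = "\<lambda>t. max 0 (2 * t - 1)"])
       (auto simp: based_loops_def)
qed

lemma homotopic_linv:
  assumes "p \<in> based_loops S x0"
  shows "homotopic_paths S (reversepath p +++ p) (\<lambda>_. x0)"
proof -
  have p: "continuous_on {0..1} p" and im: "p ` {0..1} \<subseteq> S" and ends: "p 0 = x0" "p 1 = x0"
    using assms by (auto simp: based_loops_def path_def path_image_def pathstart_def pathfinish_def)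
  let ?k = "\<lambda>z::real \<times> real. (1 - fst z) * \<bar>1 - 2 * snd z\<bar> + fst z"
  have k: "?k z \<in> {0..1}" if "z \<in> {0..1} \<times> {0..1}" for z
  proof -
    have "0 \<le> fst z" "fst z \<le> 1" "0 \<le> \<bar>1 - 2 * snd z\<bar>" "\<bar>1 - 2 * snd z\<bar> \<le> 1"
      using that by auto
    then have "0 \<le> (1 - fst z) * \<bar>1 - 2 * snd z\<bar>" "(1 - fst z) * \<bar>1 - 2 * snd z\<bar> \<le> (1 - fst z) * 1"
      by (intro mult_nonneg_nonneg mult_left_mono; simp)+
    then show ?thesis using \<open>0 \<le> fst z\<close> by simp
  qed
  define h where "h = (\<lambda>z. p (?k z))"
  have 1: "continuous_on ({0..1} \<times> {0..1}) h"
    unfolding h_def by (rule continuous_on_compose2[OF p]) (intro continuous_intros, use k in blast)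
  have 2: "h \<in> {0..1} \<times> {0..1} \<rightarrow> S"
    unfolding h_def using k im by blast
  have 3: "h (0, t) = (reversepath p +++ p) t" for t
    by (cases "t \<le> 1 / 2") (simp_all add: h_def joinpaths_def reversepath_def)
  have 4: "h (1, t) = x0" for t
    by (simp add: h_def ends)
  have 5: "h (s, 0) = x0" "h (s, 1) = x0" for s
    by (simp_all add: h_def ends)
  have 6: "pathstart (reversepath p +++ p) = x0" "pathfinish (reversepath p +++ p) = x0"
    by (simp_all add: pathstart_def pathfinish_def joinpaths_def reversepath_def ends)
  show ?thesis
    unfolding homotopic_paths
  proof (intro exI[where x = h] conjI ballI)
    fix t :: real
    show "pathstart (h \<circ> Pair t) = pathstart (reversepath p +++ p)"
      "pathfinish (h \<circ> Pair t) = pathfinish (reversepath p +++ p)"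
      unfolding 6 by (simp_all add: pathstart_def pathfinish_def 5)
  qed (rule 1 2 3 4)+
qed

lemma group_fundamental_group:
  assumes "x0 \<in> S"
  shows "group (fundamental_group S x0)"
proof (rule groupI; unfold carrier_fundamental_group)
  show "\<one>\<^bsub>fundamental_group S x0\<^esub> \<in> path_class S ` based_loops S x0"
    using based_loops_const[OF assms] by (simp add: one_fundamental_group)
next
  fix A B C
  assume "A \<in> path_class S ` based_loops S x0" "B \<in> path_class S ` based_loops S x0"
    "C \<in> path_class S ` based_loops S x0"
  then obtain p q r where pqr: "p \<in> based_loops S x0" "q \<in> based_loops S x0" "r \<in> based_loops S x0"
    and ABC: "A = path_class S p" "B = path_class S q" "C = path_class S r"
    by auto
  have "homotopic_paths S (p +++ (q +++ r)) ((p +++ q) +++ r)"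
    using pqr by (intro homotopic_paths_assoc) (auto simp: based_loops_def)
  then show "A \<otimes>\<^bsub>fundamental_group S x0\<^esub> B \<otimes>\<^bsub>fundamental_group S x0\<^esub> C =
      A \<otimes>\<^bsub>fundamental_group S x0\<^esub> (B \<otimes>\<^bsub>fundamental_group S x0\<^esub> C)"
    using pqr path_class_eqI[of S "p +++ (q +++ r)" "(p +++ q) +++ r"]
    by (simp add: ABC mult_path_class based_loops_join)
next
  fix A
  assume "A \<in> path_class S ` based_loops S x0"
  then obtain p where p: "p \<in> based_loops S x0" "A = path_class S p"
    by auto
  have "\<one>\<^bsub>fundamental_group S x0\<^esub> \<otimes>\<^bsub>fundamental_group S x0\<^esub> A
      = path_class S ((\<lambda>_. x0) +++ p)"
    unfolding one_fundamental_group p(2) by (rule mult_path_class[OF based_loops_const[OF assms] p(1)])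
  also have "\<dots> = A"
    unfolding p(2) by (rule path_class_eqI[OF homotopic_const_join[OF p(1)]])
  finally show "\<one>\<^bsub>fundamental_group S x0\<^esub> \<otimes>\<^bsub>fundamental_group S x0\<^esub> A = A" .
  have "path_class S (reversepath p) \<otimes>\<^bsub>fundamental_group S x0\<^esub> A
      = path_class S (reversepath p +++ p)"
    unfolding p(2) by (rule mult_path_class[OF based_loops_reverse[OF p(1)] p(1)])
  also have "\<dots> = \<one>\<^bsub>fundamental_group S x0\<^esub>"
    unfolding one_fundamental_group by (rule path_class_eqI[OF homotopic_linv[OF p(1)]])
  finally show "\<exists>B\<in>path_class S ` based_loops S x0.
      B \<otimes>\<^bsub>fundamental_group S x0\<^esub> A = \<one>\<^bsub>fundamental_group S x0\<^esub>"
    using based_loops_reverse[OF p(1)] by blast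
next
  fix A B
  assume "A \<in> path_class S ` based_loops S x0" "B \<in> path_class S ` based_loops S x0"
  then obtain p q where p: "p \<in> based_loops S x0" "A = path_class S p"
    and q: "q \<in> based_loops S x0" "B = path_class S q"
    by auto
  have "A \<otimes>\<^bsub>fundamental_group S x0\<^esub> B = path_class S (p +++ q)"
    unfolding p(2) q(2) by (rule mult_path_class[OF p(1) q(1)])
  then show "A \<otimes>\<^bsub>fundamental_group S x0\<^esub> B \<in> path_class S ` based_loops S x0"
    using based_loops_join[OF p(1) q(1)] by simp
qed


section \<open>Closed subgroups\<close>

definition closed_subgroup ::
    "'a::topological_space set \<Rightarrow> 'a \<Rightarrow> (real \<Rightarrow> 'a) set set \<Rightarrow> (real \<Rightarrow> 'a) set \<Rightarrow>
     'b::topological_space set \<Rightarrow> 'b \<Rightarrow> (real \<Rightarrow> 'b) set set \<Rightarrow> bool" where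
  "closed_subgroup S s0 T g X x0 H \<longleftrightarrow>
     subgroup H (fundamental_group X x0) \<and>
     (\<forall>f. continuous_on S f \<and> f \<in> S \<rightarrow> X \<and> f s0 = x0 \<and> induced_hom X f ` T \<subseteq> H
        \<longrightarrow> induced_hom X f g \<in> H)"

definition closed_closure ::
    "'a::topological_space set \<Rightarrow> 'a \<Rightarrow> (real \<Rightarrow> 'a) set set \<Rightarrow> (real \<Rightarrow> 'a) set \<Rightarrow>
     'b::topological_space set \<Rightarrow> 'b \<Rightarrow> (real \<Rightarrow> 'b) set set \<Rightarrow> (real \<Rightarrow> 'b) set set" where
  "closed_closure S s0 T g X x0 H = \<Inter>{K. closed_subgroup S s0 T g X x0 K \<and> H \<subseteq> K}"


section \<open>The Hawaiian earring with a whisker\<close>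

type_synonym plane = "real \<times> real"

definition earring_circle :: "nat \<Rightarrow> plane set" where
  "earring_circle n = sphere (1 / real n, 0) (1 / real n)"

definition earring :: "plane set" where
  "earring = (\<Union>n\<in>{1..}. earring_circle n)"

definition b0 :: plane where
  "b0 = (0, 0)"

definition earring_plus :: "plane set" where
  "earring_plus = earring \<union> {-1..0} \<times> {0}"

definition b0_plus :: plane where
  "b0_plus = (-1, 0)"

text \<open>\<open>b0\<close> is the point at angle \<open>pi\<close> as seen from the centre of each circle.\<close>

definition ell :: "nat \<Rightarrow> real \<Rightarrow> plane" where
  "ell n t = (1 / real n + cos (pi + 2 * pi * t) / real n, sin (pi + 2 * pi * t) / real n)"

text \<open>The path that is \<open>p j\<close>, linearly reparametrized, on \<open>{a j..b j}\<close> for each \<open>j \<in> J\<close>, and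
  constant at \<open>x\<close> elsewhere. It is used for intervals overlapping at most in endpoints, and loops
  \<open>p j\<close> at \<open>x\<close>, so that the choice of \<open>j\<close> does not matter.\<close>

definition insert_loops ::
    "'a \<Rightarrow> 'j set \<Rightarrow> ('j \<Rightarrow> real) \<Rightarrow> ('j \<Rightarrow> real) \<Rightarrow> ('j \<Rightarrow> real \<Rightarrow> 'a) \<Rightarrow> real \<Rightarrow> 'a" where
  "insert_loops x J a b p t =
     (if \<exists>j\<in>J. t \<in> {a j..b j}
      then let j = (SOME j. j \<in> J \<and> t \<in> {a j..b j}) in p j ((t - a j) / (b j - a j))
      else x)"

definition ell_inf :: "real \<Rightarrow> plane" where
  "ell_inf = insert_loops b0 {1..} (\<lambda>n. (real n - 1) / real n) (\<lambda>n. real n / (real n + 1)) ell"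

primrec cantor_approx :: "nat \<Rightarrow> real set" where
  "cantor_approx 0 = {0..1}"
| "cantor_approx (Suc n) =
     (\<lambda>x. x / 3) ` cantor_approx n \<union> (\<lambda>x. (x + 2) / 3) ` cantor_approx n"

definition cantor :: "real set" where
  "cantor = (\<Inter>n. cantor_approx n)"

text \<open>The components of the complement are open intervals, so \<open>Sup I - Inf I\<close> is the length of \<open>I\<close>.\<close>

definition cantor_gaps :: "nat \<Rightarrow> real set set" where
  "cantor_gaps n = {I \<in> components ({0..1} - cantor). Sup I - Inf I = 1 / 3 ^ n}"

text \<open>The \<open>k\<close>-th gap of length \<open>1 / 3 ^ n\<close> from the left, counting from \<open>k = 1\<close>.\<close>

definition cantor_gap :: "nat \<Rightarrow> nat \<Rightarrow> real set" where
  "cantor_gap n k =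
     (THE I. I \<in> cantor_gaps n \<and> card {J \<in> cantor_gaps n. Inf J \<le> Inf I} = k)"

definition cantor_gap_index :: "(nat \<times> nat) set" where
  "cantor_gap_index = {(n, k). 1 \<le> n \<and> 1 \<le> k \<and> k \<le> 2 ^ (n - 1)}"

definition ell_tau :: "real \<Rightarrow> plane" where
  "ell_tau = insert_loops b0 cantor_gap_index
     (\<lambda>(n, k). Inf (cantor_gap n k)) (\<lambda>(n, k). Sup (cantor_gap n k))
     (\<lambda>(n, k). ell (2 ^ (n - 1) + k - 1))"

definition whisker :: "real \<Rightarrow> plane" where
  "whisker t = (t - 1, 0)"

definition whisker_class :: "(real \<Rightarrow> plane) \<Rightarrow> (real \<Rightarrow> plane) set" where
  "whisker_class p = path_class earring_plus (whisker +++ p +++ reversepath whisker)"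

definition c_fin :: "nat \<Rightarrow> (real \<Rightarrow> plane) set" where
  "c_fin n = whisker_class (ell n)"

definition C_fin :: "(real \<Rightarrow> plane) set set" where
  "C_fin = generate (fundamental_group earring_plus b0_plus) (c_fin ` {1..})"

definition c_inf :: "(real \<Rightarrow> plane) set" where
  "c_inf = whisker_class ell_inf"

definition c_tau :: "(real \<Rightarrow> plane) set" where
  "c_tau = whisker_class ell_tau"

end

theory Submission
  imports Defs
begin

text \<open>
  The idea: count cuts. A loop in the earring is an infinite word in the circles, and the initial
  segments of that word can be recorded by their total windings, points of \<open>\<int>\<^sup>\<nat>\<close>. The linear order
  of the letters of \<open>ell_inf\<close> has countably many cuts, and an infinite concatenation of words with
  countably many cuts again has only countably many. The letters of \<open>ell_tau\<close> are ordered like the gaps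
  of the Cantor set, a dense order with uncountably many cuts. What is needed is a version of
  ``the set of cuts of a word'' that depends only on the homotopy class and behaves well under
  cancellation.

  Collapsing all circles but the \<open>j\<close>-th gives a map \<open>theta j\<close> to the unit circle. For a loop \<open>p\<close>, the
  lifts of all \<open>theta j \<circ> p\<close> to the line trace a path in \<open>\<real>\<^sup>\<nat>\<close> that runs along the edges of the
  integer grid. The number \<open>crossings p m v\<close> counts, with sign, how often \<open>p\<close> runs through circle
  \<open>m\<close> while its windings around the circles \<open>j < m\<close> are \<open>v j\<close>. This is the degree of a loop in the
  unit circle, obtained from \<open>p\<close> in a way that also applies to homotopies, so it is a homotopy
  invariant; under concatenation it satisfies the cocycle rule of Fox derivatives
  (\<open>crossings_homotopic\<close>, \<open>crossings_join\<close>).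

  Let \<open>visited p\<close> consist of the \<open>v\<close> with \<open>crossings p m v \<noteq> 0\<close> for infinitely many \<open>m\<close>, and let
  \<open>scattered_classes\<close> be the set of classes for which it is countable. By the cocycle rule this is
  a subgroup. It contains the classes \<open>c_fin n\<close>, for which \<open>visited\<close> is empty. It does not contain
  \<open>c_tau\<close>: every infinite branch of the tree of Cantor intervals provides a visited point, and
  different branches provide different ones (\<open>uncountable_visited_ell_tau\<close>).

  It remains to see that the subgroup is closed. Let \<open>f\<close> be a map of the based space that sends
  \<open>C_fin\<close> into the subgroup, let \<open>a\<close> be the image of the whisker, and \<open>p\<^sub>n\<close> that of \<open>ell n\<close>. If
  \<open>f b0 \<noteq> b0\<close>, then the space is locally contractible at \<open>f b0\<close>, so that the image of a tail of the
  infinite product is trivial. If \<open>f b0 = b0\<close>, then the \<open>p\<^sub>n\<close> shrink to \<open>b0\<close>, that is, they run all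
  the way round only circles of higher and higher index. An infinite product of shrinking loops
  visits, besides translates of the points visited by the factors, at most its own endpoint
  (\<open>countable_visited_infinite_product\<close>).
  The difficulty is that only the conjugates \<open>a p\<^sub>n a\<^sup>-\<close> are known to be scattered. If \<open>p\<^sub>n\<close> has
  winding \<open>0\<close>, then conjugation only translates its crossings. If infinitely many \<open>p\<^sub>n\<close> have
  nonzero winding, then a telescoping argument shows that \<open>a\<close> itself is scattered
  (\<open>countable_visited_conjugator\<close>), and then so is every \<open>p\<^sub>n\<close>.
\<close>

section \<open>Lifting paths in the unit circle\<close>

lemma cis_2pi_eq_1_iff: "cis (2 * pi * x) = 1 \<longleftrightarrow> x \<in> \<int>"
proof
  assume "cis (2 * pi * x) = 1"
  then have "cos (2 * pi * x) = 1"
    by (metis Re_complex_of_real cis.sel(1) of_real_1)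
  then obtain n :: int where "2 * pi * x = real_of_int n * 2 * pi"
    using cos_one_2pi_int by auto
  then have "x = of_int n"
    by simp
  then show "x \<in> \<int>"
    by simp
next
  assume "x \<in> \<int>"
  then show "cis (2 * pi * x) = 1"
    by (auto elim!: Ints_cases simp: cis_multiple_2pi)
qed

lemma cis_2pi_eq_iff: "cis (2 * pi * x) = cis (2 * pi * y) \<longleftrightarrow> x - y \<in> \<int>"
proof -
  have "cis (2 * pi * (x - y)) = cis (2 * pi * x) / cis (2 * pi * y)"
    by (simp add: cis_divide algebra_simps)
  then show ?thesis
    using cis_2pi_eq_1_iff[of "x - y"] by auto
qed

lemma integer_valued_constant:
  fixes f :: "'a::topological_space \<Rightarrow> real"
  assumes "connected S" "continuous_on S f" "f ` S \<subseteq> \<int>" "x \<in> S" "y \<in> S"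
  shows "f x = f y"
proof -
  have "f constant_on S"
  proof (rule continuous_discrete_range_constant[OF assms(1,2)])
    fix z assume z: "z \<in> S"
    show "\<exists>e>0. \<forall>w. w \<in> S \<and> f w \<noteq> f z \<longrightarrow> e \<le> norm (f w - f z)"
    proof (intro exI conjI allI impI)
      fix w assume w: "w \<in> S \<and> f w \<noteq> f z"
      have "f w - f z \<in> \<int>" "f w - f z \<noteq> 0"
        using w z assms(3) by (auto intro: Ints_diff)
      then show "1 \<le> norm (f w - f z)"
        using Ints_nonzero_abs_ge1 by fastforce
    qed auto
  qed
  then show ?thesis
    using assms(4,5) unfolding constant_on_def by metis
qed

lemma circle_lift_on_contractible:
  fixes q :: "'a::real_normed_vector \<Rightarrow> complex"
  assumes "contractible S" "continuous_on S q" "\<And>s. s \<in> S \<Longrightarrow> norm (q s) = 1"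
  obtains L :: "'a \<Rightarrow> real"
    where "continuous_on S L" "\<And>s. s \<in> S \<Longrightarrow> q s = cis (2 * pi * L s)"
proof -
  have "\<And>z. z \<in> S \<Longrightarrow> q z \<noteq> 0"
    using assms(3) by force
  then obtain g where g: "continuous_on S g" "\<And>x. x \<in> S \<Longrightarrow> q x = exp (g x)"
    using continuous_logarithm_on_contractible[OF assms(2,1)] by blast
  show ?thesis
  proof
    show "continuous_on S (\<lambda>s. Im (g s) / (2 * pi))"
      by (intro continuous_intros g) auto
    fix s assume s: "s \<in> S"
    have "exp (Re (g s)) = 1"
      using assms(3)[OF s] g(2)[OF s] by simp
    then show "q s = cis (2 * pi * (Im (g s) / (2 * pi)))"
      using g(2)[OF s] by (simp add: exp_eq_polar)
  qed
qed

text \<open>The lift starting at \<open>0\<close>, in units of full turns; the value at \<open>1\<close> is the degree if \<open>q\<close> is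
  a loop.\<close>

definition circle_lift :: "(real \<Rightarrow> complex) \<Rightarrow> real \<Rightarrow> real" where
  "circle_lift q = (SOME L. continuous_on {0..1} L \<and> L 0 = 0 \<and>
     (\<forall>t\<in>{0..1}. q t = cis (2 * pi * L t)))"

definition circle_path :: "(real \<Rightarrow> complex) \<Rightarrow> bool" where
  "circle_path q \<longleftrightarrow> path q \<and> (\<forall>t\<in>{0..1}. norm (q t) = 1) \<and> q 0 = 1"

lemma circle_lift_cong:
  assumes "\<And>t. t \<in> {0..1} \<Longrightarrow> q t = q' t"
  shows "circle_lift q = circle_lift q'"
  unfolding circle_lift_def using assms by (intro arg_cong[where f = Eps] ext) auto

lemma circle_lift:
  assumes "circle_path q"
  shows "continuous_on {0..1} (circle_lift q)" "circle_lift q 0 = 0"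
    and cis_circle_lift: "t \<in> {0..1} \<Longrightarrow> cis (2 * pi * circle_lift q t) = q t"
proof -
  have "contractible {0..1::real}"
    by (simp add: convex_imp_contractible)
  then obtain L where L: "continuous_on {0..1} L" "\<And>s. s \<in> {0..1} \<Longrightarrow> q s = cis (2 * pi * L s)"
    using assms circle_lift_on_contractible[of "{0..1}" q] unfolding circle_path_def path_def by blast
  have "cis (2 * pi * L 0) = 1"
    using L(2)[of 0] assms by (simp add: circle_path_def)
  then have "cis (2 * pi * (L t - L 0)) = cis (2 * pi * L t)" for t
    unfolding cis_2pi_eq_1_iff cis_2pi_eq_iff by simp
  then have "continuous_on {0..1} (\<lambda>t. L t - L 0) \<and> L 0 - L 0 = 0 \<and>
      (\<forall>t\<in>{0..1}. q t = cis (2 * pi * (L t - L 0)))"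
    using L by (auto intro: continuous_intros)
  then have "continuous_on {0..1} (circle_lift q) \<and> circle_lift q 0 = 0 \<and>
      (\<forall>t\<in>{0..1}. q t = cis (2 * pi * circle_lift q t))"
    unfolding circle_lift_def
    by (rule someI[where P = "\<lambda>L. continuous_on {0..1} L \<and> L 0 = 0 \<and>
      (\<forall>t\<in>{0..1}. q t = cis (2 * pi * L t))"])
  then show "continuous_on {0..1} (circle_lift q)" "circle_lift q 0 = 0"
    "t \<in> {0..1} \<Longrightarrow> cis (2 * pi * circle_lift q t) = q t"
    by auto
qed

lemma circle_lift_unique:
  assumes "continuous_on {0..1} L" "L 0 = 0" "\<And>s. s \<in> {0..1} \<Longrightarrow> q s = cis (2 * pi * L s)"
    and "t \<in> {0..1}"
  shows "circle_lift q t = L t"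
proof -
  have q: "circle_path q"
    unfolding circle_path_def path_def
  proof (intro conjI ballI)
    have "continuous_on {0..1} (\<lambda>s. cis (2 * pi * L s))"
      by (intro continuous_intros assms)
    then show "continuous_on {0..1} q"
      by (rule continuous_on_cong[THEN iffD1, rotated 2]) (auto simp: assms(3))
    show "norm (q s) = 1" if "s \<in> {0..1}" for s
      using that by (simp add: assms(3))
    show "q 0 = 1"
      using assms(2) assms(3)[of 0] by simp
  qed
  note l = circle_lift[OF q]
  have "circle_lift q s - L s \<in> \<int>" if "s \<in> {0..1}" for s
    using that assms(3) l(3) by (simp flip: cis_2pi_eq_iff)
  then have "circle_lift q t - L t = circle_lift q 0 - L 0"
    using assms(4) by (intro integer_valued_constant[where S = "{0..1}" and f = "\<lambda>t. circle_lift q t - L t"])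
      (auto intro!: continuous_intros assms l)
  then show ?thesis
    using assms(2) l(2) by simp
qed

lemma circle_lift_1_Ints:
  assumes "circle_path q" "q 1 = 1"
  shows "circle_lift q 1 \<in> \<int>"
  using cis_circle_lift[OF assms(1), of 1] assms(2) by (simp add: cis_2pi_eq_1_iff)

lemma circle_lift_const:
  assumes "\<And>s. s \<in> {0..1} \<Longrightarrow> q s = 1" "t \<in> {0..1}"
  shows "circle_lift q t = 0"
  using assms by (intro circle_lift_unique[where L = "\<lambda>_. 0"]) auto

lemma circle_lift_join:
  assumes "circle_path q" "circle_path q'" "q 1 = 1" "t \<in> {0..1}"
  shows "circle_lift (q +++ q') t =
    (if t \<le> 1/2 then circle_lift q (2 * t) else circle_lift q 1 + circle_lift q' (2 * t - 1))"
proof -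
  note l = circle_lift[OF assms(1)] and l' = circle_lift[OF assms(2)]
  let ?L = "circle_lift q +++ (\<lambda>t. circle_lift q 1 + circle_lift q' t)"
  have "circle_lift (q +++ q') t = ?L t"
  proof (rule circle_lift_unique)
    have "path ?L"
      by (rule path_join_imp)
        (auto simp: path_def pathstart_def pathfinish_def l l' intro!: continuous_intros)
    then show "continuous_on {0..1} ?L"
      by (simp add: path_def)
    show "?L 0 = 0"
      by (simp add: joinpaths_def l)
    fix s :: real assume s: "s \<in> {0..1}"
    show "(q +++ q') s = cis (2 * pi * ?L s)"
    proof (cases "s \<le> 1/2")
      case True
      then show ?thesis
        using s by (simp add: joinpaths_def l)
    next
      case False
      have "cis (2 * pi * (circle_lift q 1 + circle_lift q' (2 * s - 1))) =
          cis (2 * pi * circle_lift q' (2 * s - 1))"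
        using circle_lift_1_Ints[OF assms(1,3)] by (simp add: cis_2pi_eq_iff)
      then show ?thesis
        using False s by (simp add: joinpaths_def l')
    qed
  qed (use assms in auto)
  then show ?thesis
    by (simp add: joinpaths_def)
qed

text \<open>Lifting each row of a square separately gives a continuous function: a lift of the whole square
  exists because the square is contractible, and its values on the left side are integers, so that
  subtracting them turns it into the normalized lift of every row.\<close>

lemma circle_lift_square:
  fixes G :: "real \<Rightarrow> real \<Rightarrow> complex"
  assumes G: "continuous_on ({0..1} \<times> {0..1}) (\<lambda>(s, t). G s t)"
    and norm: "\<And>s t. s \<in> {0..1} \<Longrightarrow> t \<in> {0..1} \<Longrightarrow> norm (G s t) = 1"
    and base: "\<And>s. s \<in> {0..1} \<Longrightarrow> G s 0 = 1"
  shows "continuous_on ({0..1} \<times> {0..1}) (\<lambda>(s, t). circle_lift (G s) t)"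
proof -
  have "contractible ({0..1::real} \<times> {0..1::real})"
    by (intro convex_imp_contractible convex_Times) auto
  moreover have "norm (case z of (s, t) \<Rightarrow> G s t) = 1" if "z \<in> {0..1} \<times> {0..1}" for z
    using that norm by auto
  ultimately obtain L where L: "continuous_on ({0..1} \<times> {0..1}) L"
    and "\<And>z. z \<in> {0..1} \<times> {0..1} \<Longrightarrow> (case z of (s, t) \<Rightarrow> G s t) = cis (2 * pi * L z)"
    using circle_lift_on_contractible[OF _ G] by metis
  then have L: "continuous_on ({0..1} \<times> {0..1}) L"
    "\<And>s t. s \<in> {0..1} \<Longrightarrow> t \<in> {0..1} \<Longrightarrow> G s t = cis (2 * pi * L (s, t))"
    by auto
  have L0: "L (s, 0) \<in> \<int>" if "s \<in> {0..1}" for s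
    using base[OF that] L(2)[OF that, of 0] by (simp add: cis_2pi_eq_1_iff)
  have "circle_lift (G s) t = L (s, t) - L (s, 0)" if s: "s \<in> {0..1}" and t: "t \<in> {0..1}" for s t
  proof (rule circle_lift_unique[where L = "\<lambda>t. L (s, t) - L (s, 0)"])
    show "continuous_on {0..1} (\<lambda>t. L (s, t) - L (s, 0))"
      using s by (intro continuous_intros continuous_on_compose2[OF L(1)]) auto
    show "G s r = cis (2 * pi * (L (s, r) - L (s, 0)))" if "r \<in> {0..1}" for r
      using L(2)[OF s that] L0[OF s] by (simp add: cis_2pi_eq_iff)
  qed (use t in auto)
  moreover have "continuous_on ({0..1} \<times> {0..1}) (\<lambda>z. L z - L (fst z, 0))"
    by (intro continuous_intros L continuous_on_compose2[OF L(1)]) auto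
  ultimately show ?thesis
    by (elim continuous_on_cong[THEN iffD1, rotated 2]) auto
qed

text \<open>Homotopic loops in the circle have the same degree; the degree is an integer that depends
  continuously on the parameter of the homotopy.\<close>

lemma circle_lift_homotopy:
  fixes G :: "real \<Rightarrow> real \<Rightarrow> complex"
  assumes "continuous_on ({0..1} \<times> {0..1}) (\<lambda>(s, t). G s t)"
    and "\<And>s t. s \<in> {0..1} \<Longrightarrow> t \<in> {0..1} \<Longrightarrow> norm (G s t) = 1"
    and "\<And>s. s \<in> {0..1} \<Longrightarrow> G s 0 = 1" "\<And>s. s \<in> {0..1} \<Longrightarrow> G s 1 = 1"
  shows "circle_lift (G 0) 1 = circle_lift (G 1) 1"
proof (rule integer_valued_constant[where S = "{0..1}" and f = "\<lambda>s. circle_lift (G s) 1"])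
  show "continuous_on {0..1} (\<lambda>s. circle_lift (G s) 1)"
    using continuous_on_compose2[OF circle_lift_square[OF assms(1-3)], of "{0..1}" "\<lambda>s. (s, 1)"]
    by (force intro: continuous_intros)
  have "circle_path (G s)" if "s \<in> {0..1}" for s
    using continuous_on_compose2[OF assms(1), of "{0..1}" "\<lambda>t. (s, t)"] that assms(2,3)
    by (force simp: circle_path_def path_def intro: continuous_intros)
  then show "(\<lambda>s. circle_lift (G s) 1) ` {0..1} \<subseteq> \<int>"
    using assms(4) circle_lift_1_Ints by auto
qed auto

text \<open>A path that misses the point opposite to its start cannot make half a turn.\<close>

lemma circle_lift_small:
  assumes q: "circle_path q" and "\<And>s. s \<in> {0..1} \<Longrightarrow> q s \<noteq> -1" "t \<in> {0..1}"
  shows "\<bar>circle_lift q t\<bar> < 1/2"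
proof (rule ccontr)
  assume "\<not> ?thesis"
  then have "1/2 \<le> \<bar>circle_lift q t\<bar>"
    by simp
  moreover have "continuous_on {0..t} (\<lambda>t. \<bar>circle_lift q t\<bar>)"
    using assms(3) by (intro continuous_intros continuous_on_subset[OF circle_lift(1)[OF q]]) auto
  ultimately obtain s where s: "0 \<le> s" "s \<le> t" "\<bar>circle_lift q s\<bar> = 1/2"
    using IVT'[of "\<lambda>t. \<bar>circle_lift q t\<bar>" 0 "1/2" t] assms(3) circle_lift(2)[OF q] by auto
  then have "circle_lift q s = 1/2 \<or> circle_lift q s = -1/2"
    by linarith
  then have "cis (2 * pi * circle_lift q s) = -1"
  proof
    assume "circle_lift q s = 1/2"
    then have "2 * pi * circle_lift q s = pi"
      by simp
    then show ?thesis
      by (metis cis_pi)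
  next
    assume "circle_lift q s = -1/2"
    then have "2 * pi * circle_lift q s = -pi"
      by simp
    then have "cis (2 * pi * circle_lift q s) = cnj (cis pi)"
      by (metis cis_cnj)
    then show ?thesis
      by simp
  qed
  then show False
    using assms(2)[of s] assms(3) s circle_lift(3)[OF q, of s] by simp
qed

lemma small_Ints_zero:
  assumes "x \<in> \<int>" "\<bar>x\<bar> < (1/2::real)"
  shows "x = 0"
  using assms Ints_nonzero_abs_ge1[of x] by fastforce


section \<open>Collapsing the earring onto one circle\<close>

text \<open>The retraction onto the \<open>j\<close>-th circle, scaled to the unit circle and turned so that \<open>b0\<close> goes to
  \<open>1\<close>. The condition is the equation of the circle, see \<open>earring_circle_iff\<close>.
  For \<open>j = 0\<close> the function is constantly \<open>1\<close>, so that conditions on all \<open>j < m\<close> may include \<open>0\<close>.\<close>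

definition theta :: "nat \<Rightarrow> plane \<Rightarrow> complex" where
  "theta j z =
     (if real j * ((fst z)\<^sup>2 + (snd z)\<^sup>2) = 2 * fst z
      then Complex (1 - real j * fst z) (- (real j * snd z)) else 1)"

lemma earring_circle_iff:
  assumes "n \<ge> 1"
  shows "z \<in> earring_circle n \<longleftrightarrow> real n * ((fst z)\<^sup>2 + (snd z)\<^sup>2) = 2 * fst z"
proof -
  have n: "real n > 0"
    using assms by simp
  obtain x y where z: "z = (x, y)"
    by (cases z)
  have "z \<in> earring_circle n \<longleftrightarrow> sqrt ((1 / n - x)\<^sup>2 + y\<^sup>2) = 1 / n"
    by (simp add: z earring_circle_def dist_Pair_Pair dist_real_def)
  also have "\<dots> \<longleftrightarrow> (1 / n - x)\<^sup>2 + y\<^sup>2 = (1 / n)\<^sup>2"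
    using n by (metis real_sqrt_eq_iff real_sqrt_abs abs_of_pos zero_less_divide_1_iff)
  also have "(1 / n - x)\<^sup>2 + y\<^sup>2 = (1 / n)\<^sup>2 + ((x\<^sup>2 + y\<^sup>2) - 2 * x / n)"
    by (simp add: power2_eq_square algebra_simps)
  also have "\<dots> = (1 / n)\<^sup>2 \<longleftrightarrow> real n * (x\<^sup>2 + y\<^sup>2) = 2 * x"
    using n by (simp add: eq_divide_eq mult.commute)
  finally show ?thesis
    by (simp add: z)
qed

lemma earring_plus_cases:
  assumes "z \<in> earring_plus"
  obtains (circle) n where "n \<ge> 1" "real n * ((fst z)\<^sup>2 + (snd z)\<^sup>2) = 2 * fst z"
    | (whisker) "snd z = 0" "-1 \<le> fst z" "fst z \<le> 0"
proof (cases "z \<in> earring")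
  case True
  then show ?thesis
    using circle earring_circle_iff unfolding earring_def by auto
next
  case False
  then show ?thesis
    using whisker assms unfolding earring_plus_def by auto
qed

lemma theta_b0 [simp]: "theta j b0 = 1"
  by (simp add: theta_def b0_def complex_eq_iff)

lemma theta_whisker: "x \<le> 0 \<Longrightarrow> theta j (x, 0) = 1"
proof -
  assume "x \<le> 0"
  have "x = 0" if "real j * x\<^sup>2 = 2 * x"
    using that \<open>x \<le> 0\<close> by (smt (verit) mult_nonneg_nonneg of_nat_0_le_iff zero_le_power2)
  then show ?thesis
    by (auto simp: theta_def complex_eq_iff)
qed

lemma norm_theta: "norm (theta j z) = 1"
proof (cases "real j * ((fst z)\<^sup>2 + (snd z)\<^sup>2) = 2 * fst z")
  case True
  have "(1 - real j * fst z)\<^sup>2 + (real j * snd z)\<^sup>2 =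
      1 - real j * (2 * fst z) + real j * (real j * ((fst z)\<^sup>2 + (snd z)\<^sup>2))"
    by (simp add: power2_eq_square algebra_simps)
  then have "(1 - real j * fst z)\<^sup>2 + (real j * snd z)\<^sup>2 = 1"
    unfolding True by simp
  then show ?thesis
    using True by (simp add: theta_def cmod_def)
qed (simp add: theta_def)

text \<open>Different circles meet only at \<open>b0\<close>.\<close>

lemma theta_neq_1_unique:
  assumes "theta i z \<noteq> 1" "theta j z \<noteq> 1"
  shows "i = j"
proof -
  let ?q = "(fst z)\<^sup>2 + (snd z)\<^sup>2"
  have q: "real i * ?q = 2 * fst z" "real j * ?q = 2 * fst z"
    using assms by (auto simp: theta_def split: if_splits)
  have "?q \<noteq> 0"
  proof
    assume "?q = 0"
    then have "fst z = 0" "snd z = 0"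
      by (auto simp: sum_power2_eq_zero_iff)
    then show False
      using assms(1) by (simp add: theta_def complex_eq_iff)
  qed
  then show ?thesis
    using q by (metis mult_cancel_right of_nat_eq_iff)
qed

lemma theta_0 [simp]: "theta 0 z = 1"
  by (simp add: theta_def complex_eq_iff)

lemma theta_ell_same: "j \<ge> 1 \<Longrightarrow> theta j (ell j t) = cis (2 * pi * t)"
proof -
  assume j: "j \<ge> 1"
  let ?c = "cos (2 * pi * t)" and ?s = "sin (2 * pi * t)"
  have e: "ell j t = ((1 - ?c) / j, - ?s / j)"
    by (simp add: ell_def diff_divide_distrib)
  have "(1 - ?c)\<^sup>2 + ?s\<^sup>2 = 2 * (1 - ?c)"
    using sin_cos_squared_add2[of "2 * pi * t"] by (simp add: power2_eq_square algebra_simps)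
  then have "real j * (((1 - ?c) / j)\<^sup>2 + (- ?s / j)\<^sup>2) = 2 * ((1 - ?c) / j)"
    using j by (simp add: power_divide add_divide_distrib[symmetric] power2_eq_square)
  then show ?thesis
    using j by (simp add: theta_def e cis.code)
qed

lemma ell_on_circle:
  assumes "n \<ge> 1"
  shows "ell n t \<in> earring_circle n"
proof (cases "theta n (ell n t) = 1")
  case True
  then have "cos (2 * pi * t) = 1" "sin (2 * pi * t) = 0"
    using assms by (auto simp: theta_ell_same complex_eq_iff)
  then show ?thesis
    unfolding earring_circle_iff[OF assms] by (simp add: ell_def)
next
  case False
  then show ?thesis
    unfolding earring_circle_iff[OF assms] by (auto simp: theta_def split: if_splits)
qed

lemma ell_in_earring_plus: "n \<ge> 1 \<Longrightarrow> ell n t \<in> earring_plus"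
  using ell_on_circle unfolding earring_plus_def earring_def by blast

lemma theta_ell_other:
  assumes "n \<ge> 1" "j \<noteq> n"
  shows "theta j (ell n t) = 1"
proof (cases "theta n (ell n t) = 1")
  case True
  then have "cos (2 * pi * t) = 1" "sin (2 * pi * t) = 0"
    using assms by (auto simp: theta_ell_same complex_eq_iff)
  then have "ell n t = b0"
    by (simp add: ell_def b0_def)
  then show ?thesis
    by simp
next
  case False
  then show ?thesis
    using theta_neq_1_unique assms(2) by blast
qed

lemma ell_0: "ell n 0 = b0" and ell_1: "ell n 1 = b0"
  by (simp_all add: ell_def b0_def)

lemma continuous_on_ell: "continuous_on S (ell n)"
  unfolding ell_def by (cases "n = 0") (auto intro!: continuous_intros)

lemma on_circle_eq_ell:
  assumes "j \<ge> 1" "theta j z \<noteq> 1" "theta j z = cis (2 * pi * s)"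
  shows "z = ell j s"
proof -
  have "1 - real j * fst z = cos (2 * pi * s)" "- (real j * snd z) = sin (2 * pi * s)"
    using assms(2,3) by (auto simp: theta_def complex_eq_iff split: if_splits)
  then have "fst z = (1 - cos (2 * pi * s)) / j" "snd z = - sin (2 * pi * s) / j"
    using assms(1) by (simp_all add: field_simps)
  then show ?thesis
    by (simp add: ell_def prod_eq_iff diff_divide_distrib)
qed

text \<open>The smaller circles lie in the disc bounded by circle \<open>j + 1\<close>, the larger ones and the whisker lie
  outside the open disc bounded by circle \<open>j - 1\<close> (a half-plane if \<open>j = 1\<close>). Both regions are closed, and they meet circle
  \<open>j\<close> only in \<open>b0\<close>. This replaces a limit argument in the proof that \<open>theta j\<close> is continuous.\<close>

definition off_circle :: "nat \<Rightarrow> plane set" where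
  "off_circle j =
     {z. (real j + 1) * ((fst z)\<^sup>2 + (snd z)\<^sup>2) \<le> 2 * fst z} \<union>
     {z. 2 * fst z \<le> (real j - 1) * ((fst z)\<^sup>2 + (snd z)\<^sup>2)}"

lemma closed_off_circle: "closed (off_circle j)"
  unfolding off_circle_def by (intro closed_Un closed_Collect_le continuous_intros)

lemma theta_off_circle: "z \<in> off_circle j \<Longrightarrow> theta j z = 1"
proof -
  assume z: "z \<in> off_circle j"
  let ?q = "(fst z)\<^sup>2 + (snd z)\<^sup>2"
  have "?q = 0" if "real j * ?q = 2 * fst z"
  proof -
    have "?q \<le> 0"
      using z that unfolding off_circle_def by (auto simp: algebra_simps)
    then show ?thesis
      by (simp add: sum_power2_le_zero_iff)
  qed
  then have "fst z = 0" "snd z = 0" if "real j * ?q = 2 * fst z"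
    using that by (auto simp: sum_power2_eq_zero_iff)
  then show ?thesis
    by (auto simp: theta_def complex_eq_iff)
qed

lemma earring_plus_off_circle:
  assumes "z \<in> earring_plus" "real j * ((fst z)\<^sup>2 + (snd z)\<^sup>2) \<noteq> 2 * fst z" "j \<ge> 1"
  shows "z \<in> off_circle j"
  using assms(1)
proof (cases rule: earring_plus_cases)
  case (circle n)
  let ?q = "(fst z)\<^sup>2 + (snd z)\<^sup>2"
  have "n \<noteq> j"
    using circle assms(2) by auto
  then consider "real n \<le> real j - 1" | "real j + 1 \<le> real n"
    by linarith
  then show ?thesis
  proof cases
    case 1
    then have "real n * ?q \<le> (real j - 1) * ?q"
      by (intro mult_right_mono) auto
    then show ?thesis
      using circle by (simp add: off_circle_def)
  next
    case 2
    then have "(real j + 1) * ?q \<le> real n * ?q"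
      by (intro mult_right_mono) auto
    then show ?thesis
      using circle by (simp add: off_circle_def)
  qed
next
  case whisker
  have "0 \<le> (real j - 1) * ((fst z)\<^sup>2 + (snd z)\<^sup>2)"
    using assms(3) by (intro mult_nonneg_nonneg) auto
  then have "2 * fst z \<le> (real j - 1) * ((fst z)\<^sup>2 + (snd z)\<^sup>2)"
    using whisker(3) by linarith
  then show ?thesis
    by (simp add: off_circle_def)
qed

lemma continuous_on_theta: "continuous_on earring_plus (theta j)"
proof (cases "j = 0")
  case False
  define C where "C = {z :: plane. real j * ((fst z)\<^sup>2 + (snd z)\<^sup>2) = 2 * fst z}"
  have "continuous_on C (theta j)"
  proof (rule continuous_on_cong[THEN iffD1, rotated 2])
    show "continuous_on C (\<lambda>z. Complex (1 - real j * fst z) (- (real j * snd z)))"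
      unfolding Complex_eq by (intro continuous_intros)
  qed (auto simp: C_def theta_def)
  moreover have "continuous_on (off_circle j) (theta j)"
    by (rule continuous_on_cong[THEN iffD1, rotated 2, OF continuous_on_const[of _ 1]])
      (auto simp: theta_off_circle)
  moreover have "closed C"
    unfolding C_def by (intro closed_Collect_eq continuous_intros)
  ultimately have "continuous_on (C \<union> off_circle j) (theta j)"
    using closed_off_circle by (intro continuous_on_closed_Un)
  moreover have "earring_plus \<subseteq> C \<union> off_circle j"
    using earring_plus_off_circle False unfolding C_def by fastforce
  ultimately show ?thesis
    by (rule continuous_on_subset)
next
  case True
  then have "theta j = (\<lambda>_. 1)"
    by auto
  then show ?thesis
    by simp
qed

lemma convex_whisker_space: "convex ({-1..0::real} \<times> {0::real})"
  by (intro convex_Times) auto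

text \<open>Away from \<open>b0\<close> the space is locally an interval: near a point of the whisker it is a segment, and near
  a point of circle \<open>j\<close> a loop is the image under \<open>ell j\<close> of a loop in the real line.\<close>

lemma small_loop_nullhomotopic:
  assumes x: "x \<in> earring_plus" "x \<noteq> b0"
  obtains r where "r > 0"
    "\<And>p. \<lbrakk>path p; path_image p \<subseteq> earring_plus \<inter> ball x r; pathstart p = x; pathfinish p = x\<rbrakk>
      \<Longrightarrow> homotopic_paths earring_plus p (linepath x x)"
  using x(1)
proof (cases rule: earring_plus_cases)
  case whisker
  have neg: "fst x < 0"
    using whisker x(2) by (metis b0_def less_eq_real_def prod.collapse)
  show ?thesis
  proof (rule that[of "- fst x"])
    fix p assume p: "path p" "path_image p \<subseteq> earring_plus \<inter> ball x (- fst x)"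
      "pathstart p = x" "pathfinish p = x"
    have "z \<in> {-1..0} \<times> {0}" if "z \<in> earring_plus \<inter> ball x (- fst x)" for z
    proof -
      have "\<bar>fst x - fst z\<bar> < - fst x"
        using that dist_fst_le[of x z] by (auto simp: dist_real_def)
      then have z: "fst z < 0"
        by linarith
      have "z \<in> earring_plus"
        using that by simp
      then show ?thesis
      proof (cases rule: earring_plus_cases)
        case (circle n)
        have "0 \<le> real n * ((fst z)\<^sup>2 + (snd z)\<^sup>2)"
          by simp
        then show ?thesis
          using circle z by linarith
      next
        case whisker
        then show ?thesis
          by (cases z) auto
      qed
    qed
    then have im: "p t \<in> {-1..0} \<times> {0}" if "t \<in> {0..1}" for t
      using p(2) that unfolding path_image_def by blast
    have x': "x \<in> {-1..0} \<times> {0}"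
      using im[of 0] p(3) by (simp add: pathstart_def)
    show "homotopic_paths earring_plus p (linepath x x)"
    proof (rule homotopic_paths_linear)
      fix t :: real assume "t \<in> {0..1}"
      then have "closed_segment (p t) (linepath x x t) \<subseteq> {-1..0} \<times> {0}"
        using x' unfolding linepath_refl by (intro closed_segment_subset im convex_whisker_space)
      then show "closed_segment (p t) (linepath x x t) \<subseteq> earring_plus"
        by (auto simp: earring_plus_def)
    qed (use p in auto)
  qed (use neg in simp)
next
  case (circle j)
  define O' where "O' = {z :: plane. 2 * fst z < (real j + 1) * ((fst z)\<^sup>2 + (snd z)\<^sup>2)} \<inter>
     {z. (real j - 1) * ((fst z)\<^sup>2 + (snd z)\<^sup>2) < 2 * fst z}"
  have "open O'"
    unfolding O'_def by (intro open_Int open_Collect_less continuous_intros)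
  moreover have "x \<in> O'"
  proof -
    have "(fst x)\<^sup>2 + (snd x)\<^sup>2 > 0"
      using x(2) by (metis b0_def prod.collapse sum_power2_gt_zero_iff)
    then show ?thesis
      using circle(2) unfolding O'_def by (auto simp: algebra_simps)
  qed
  ultimately obtain r where r: "r > 0" "ball x r \<subseteq> O'"
    using open_contains_ball by blast
  show ?thesis
  proof (rule that[of r])
    fix p assume p: "path p" "path_image p \<subseteq> earring_plus \<inter> ball x r"
      "pathstart p = x" "pathfinish p = x"
    have th: "theta j z \<noteq> 1" if "z \<in> earring_plus \<inter> ball x r" for z
    proof
      assume th: "theta j z = 1"
      have z: "z \<in> O'" "z \<in> earring_plus"
        using that r(2) by auto
      then have on: "real j * ((fst z)\<^sup>2 + (snd z)\<^sup>2) = 2 * fst z"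
        using earring_plus_off_circle[of z j] circle(1) by (fastforce simp: O'_def off_circle_def)
      then have "fst z = 0"
        using th circle(1) by (auto simp: theta_def complex_eq_iff)
      moreover from this have "snd z = 0"
        using on circle(1) by auto
      ultimately show False
        using z(1) by (simp add: O'_def)
    qed
    have pth: "theta j (p t) \<noteq> 1" if "t \<in> {0..1}" for t
      using th p(2) that unfolding path_image_def by (meson image_subset_iff)
    have "continuous_on {0..1} (theta j \<circ> p)"
      using p(1,2) unfolding path_def path_image_def
      by (intro continuous_on_compose continuous_on_subset[OF continuous_on_theta]) auto
    then obtain L where L: "continuous_on {0..1} L"
      "\<And>t. t \<in> {0..1} \<Longrightarrow> (theta j \<circ> p) t = cis (2 * pi * L t)"
      using circle_lift_on_contractible[of "{0..1::real}" "theta j \<circ> p"] norm_theta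
      by (metis comp_apply convex_imp_contractible convex_real_interval(5))
    have LZ: "L t \<notin> \<int>" if "t \<in> {0..1}" for t
      using pth[OF that] L(2)[OF that] by (simp flip: cis_2pi_eq_1_iff)
    have pL: "p t = ell j (L t)" if "t \<in> {0..1}" for t
      using on_circle_eq_ell[OF circle(1) pth[OF that]] L(2)[OF that] by simp
    \<comment> \<open>the lift avoids the integers, so it stays in one unit interval and closes up\<close>
    have "L 1 = L 0"
    proof (rule ccontr)
      assume ne: "L 1 \<noteq> L 0"
      have "cis (2 * pi * L 1) = cis (2 * pi * L 0)"
        using L(2)[of 0] L(2)[of 1] p(3,4) by (simp add: pathstart_def pathfinish_def)
      then have "L 1 - L 0 \<in> \<int>"
        by (simp add: cis_2pi_eq_iff)
      then have ge: "\<bar>L 1 - L 0\<bar> \<ge> 1"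
        using ne Ints_nonzero_abs_ge1[of "L 1 - L 0"] by simp
      have "\<exists>t\<in>{0..1}. L t = of_int \<lceil>min (L 0) (L 1)\<rceil>"
      proof (cases "L 0 \<le> L 1")
        case True
        then have "L 0 \<le> of_int \<lceil>L 0\<rceil>" "of_int \<lceil>L 0\<rceil> \<le> L 1"
          using ge by linarith+
        then show ?thesis
          using IVT'[of L 0 "of_int \<lceil>L 0\<rceil>" 1] L(1) True by (auto simp: min_def)
      next
        case False
        then have "L 1 \<le> of_int \<lceil>L 1\<rceil>" "of_int \<lceil>L 1\<rceil> \<le> L 0"
          using ge by linarith+
        then show ?thesis
          using IVT2'[of L 1 "of_int \<lceil>L 1\<rceil>" 0] L(1) False by (auto simp: min_def)
      qed
      then show False
        using LZ by fastforce
    qed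
    have "homotopic_paths UNIV L (linepath (L 0) (L 0))"
      using L(1) \<open>L 1 = L 0\<close>
      by (intro homotopic_paths_linear path_linepath)
        (auto simp: path_def pathstart_def pathfinish_def linepath_refl)
    then have "homotopic_paths earring_plus (ell j \<circ> L) (ell j \<circ> linepath (L 0) (L 0))"
      using ell_in_earring_plus[OF circle(1)]
      by (intro homotopic_paths_continuous_image[OF _ continuous_on_ell]) auto
    moreover have "ell j \<circ> linepath (L 0) (L 0) = linepath x x"
      using pL[of 0] p(3) by (auto simp: linepath_refl pathstart_def)
    moreover have "homotopic_paths earring_plus p (ell j \<circ> L)"
      using p(1,2) pL by (intro homotopic_paths_eq) auto
    ultimately show "homotopic_paths earring_plus p (linepath x x)"
      using homotopic_paths_trans by metis
  qed (rule r(1))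
qed


section \<open>Signed crossings of a circle at a vertex of the grid\<close>

text \<open>The endpoints are required to lie where no circle is being traversed: at \<open>b0\<close> or on the whisker.
  Paths rather than loops are needed, since the image of the whisker under a map is such a path.\<close>

definition anchored :: "(real \<Rightarrow> plane) \<Rightarrow> bool" where
  "anchored p \<longleftrightarrow> path p \<and> path_image p \<subseteq> earring_plus \<and>
     (\<forall>j. theta j (pathstart p) = 1 \<and> theta j (pathfinish p) = 1)"

definition position :: "(real \<Rightarrow> plane) \<Rightarrow> nat \<Rightarrow> real \<Rightarrow> real" where
  "position p j = circle_lift (theta j \<circ> p)"

definition winding :: "(real \<Rightarrow> plane) \<Rightarrow> nat \<Rightarrow> real" where
  "winding p j = position p j 1"

text \<open>Follow \<open>p\<close> around circle \<open>m\<close>, but only at the times when the gate is open, that is, when \<open>p\<close> is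
  at the vertex \<open>v\<close> of the grid formed by the circles of smaller index.\<close>

definition gated :: "(real \<Rightarrow> plane) \<Rightarrow> nat \<Rightarrow> (nat \<Rightarrow> real) \<Rightarrow> real \<Rightarrow> complex" where
  "gated p m v t = (if \<forall>j<m. position p j t = v j then theta m (p t) else 1)"

text \<open>The signed number of traversals of circle \<open>m\<close> through the open gate. In terms of free groups this is,
  for integral \<open>v\<close>, a coefficient of the Fox derivative of the word of \<open>p\<close> with respect to the last of
  \<open>m\<close> generators, taken in the group ring of \<open>\<int>\<^sup>m\<^sup>-\<^sup>1\<close>.\<close>

definition crossings :: "(real \<Rightarrow> plane) \<Rightarrow> nat \<Rightarrow> (nat \<Rightarrow> real) \<Rightarrow> real" where
  "crossings p m v = circle_lift (gated p m v) 1"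

lemma anchored_theta_path:
  assumes "anchored p"
  shows "circle_path (theta j \<circ> p)" "(theta j \<circ> p) 1 = 1"
proof -
  have "continuous_on {0..1} (theta j \<circ> p)"
    using assms unfolding anchored_def path_def path_image_def
    by (intro continuous_on_compose continuous_on_subset[OF continuous_on_theta]) auto
  then show "circle_path (theta j \<circ> p)" "(theta j \<circ> p) 1 = 1"
    using assms norm_theta by (auto simp: circle_path_def path_def anchored_def pathstart_def pathfinish_def)
qed

text \<open>While circle \<open>m\<close> is being traversed, the other coordinates are integers and hence locally constant, so
  the gate can open or close only at times when \<open>theta m\<close> is \<open>1\<close>. The domain is arbitrary because the
  lemma serves both for paths and for homotopies.\<close>

lemma continuous_on_gate:
  fixes P :: "'a::metric_space \<Rightarrow> plane"
  assumes P: "continuous_on S P" "P ` S \<subseteq> earring_plus"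
    and L: "\<And>j. continuous_on S (L j)" "\<And>j s. s \<in> S \<Longrightarrow> cis (2 * pi * L j s) = theta j (P s)"
  shows "continuous_on S (\<lambda>s. if \<forall>j<m. L j s = v j then theta m (P s) else 1)"
proof -
  let ?g = "\<lambda>s. if \<forall>j<m. L j s = v j then theta m (P s) else 1"
  define A where "A = {s \<in> S. \<forall>j<m. L j s = v j}"
  \<comment> \<open>the function is \<open>theta m \<circ> P\<close> on \<open>A\<close> and \<open>1\<close> on \<open>B\<close>; every set of integers is closed\<close>
  define B where "B = {s \<in> S. theta m (P s) = 1} \<union> (\<Union>j<m. {s \<in> S. L j s \<in> \<int> - {v j}})"
  have th: "continuous_on S (\<lambda>s. theta m (P s))"
    using continuous_on_compose2[OF continuous_on_theta P] .
  have "closedin (top_of_set S) (\<Inter>j\<in>{..<m}. {s \<in> S. L j s = v j})" if "m > 0"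
    using that by (intro closedin_INT continuous_closedin_preimage_constant L) auto
  moreover have "A = S \<inter> (\<Inter>j\<in>{..<m}. {s \<in> S. L j s = v j})"
    unfolding A_def by auto
  ultimately have A: "closedin (top_of_set S) A"
    by (cases "m > 0") auto
  have "closedin (top_of_set S) (S \<inter> L j -` (\<int> - {v j}))" for j
    by (intro continuous_closedin_preimage L closed_subset_Ints) auto
  moreover have "S \<inter> L j -` (\<int> - {v j}) = {s \<in> S. L j s \<in> \<int> - {v j}}" for j
    by auto
  ultimately have "closedin (top_of_set S) {s \<in> S. L j s \<in> \<int> - {v j}}" for j
    by metis
  then have B: "closedin (top_of_set S) B"
    unfolding B_def
    by (intro closedin_Un closedin_Union continuous_closedin_preimage_constant th) auto
  have "S \<subseteq> A \<union> B"
  proof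
    fix s assume s: "s \<in> S"
    show "s \<in> A \<union> B"
    proof (rule ccontr)
      assume n: "s \<notin> A \<union> B"
      then obtain j where j: "j < m" "L j s \<noteq> v j" and "theta m (P s) \<noteq> 1"
        using s by (auto simp: A_def B_def)
      then have "theta j (P s) = 1"
        using theta_neq_1_unique[of j "P s" m] by auto
      then have "L j s \<in> \<int>"
        using L(2)[OF s, of j] by (simp add: cis_2pi_eq_1_iff)
      then show False
        using n j s by (auto simp: B_def)
    qed
  qed
  then have S: "S = A \<union> B"
    by (auto simp: A_def B_def)
  have "continuous_on A ?g"
    by (rule continuous_on_cong[THEN iffD1, rotated 2, OF continuous_on_subset[OF th]])
      (auto simp: A_def)
  moreover have "continuous_on B ?g"
    by (rule continuous_on_cong[THEN iffD1, rotated 2, OF continuous_on_const[of _ 1]])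
      (auto simp: B_def)
  ultimately show ?thesis
    using continuous_on_Un_local[of A B ?g] A B S by metis
qed

lemma gated_path:
  assumes "anchored p"
  shows "circle_path (gated p m v)" "gated p m v 1 = 1"
proof -
  note l = circle_lift[OF anchored_theta_path(1)[OF assms]]
  have "continuous_on {0..1} (gated p m v)"
    unfolding gated_def position_def
    using assms by (intro continuous_on_gate l) (auto simp: anchored_def path_def path_image_def l)
  then show "circle_path (gated p m v)" "gated p m v 1 = 1"
    using assms
    by (auto simp: circle_path_def path_def gated_def norm_theta anchored_def pathstart_def pathfinish_def)
qed

lemma crossings_support:
  assumes "crossings p m v \<noteq> 0"
  obtains t where "t \<in> {0..1}" "\<And>j. j < m \<Longrightarrow> position p j t = v j" "theta m (p t) \<noteq> 1"
proof -
  have "\<exists>t\<in>{0..1}. gated p m v t \<noteq> 1"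
    using circle_lift_const[of "gated p m v" 1] assms unfolding crossings_def by fastforce
  then show ?thesis
    using that unfolding gated_def by metis
qed

text \<open>The lifts of the rows of a homotopy fit together to continuous coordinates on the square, so that the
  gated paths of the rows form a homotopy of loops in the circle.\<close>

lemma crossings_homotopic:
  assumes h: "homotopic_paths earring_plus p q" and p: "anchored p"
  shows "winding p j = winding q j" "crossings p m v = crossings q m v"
proof -
  obtain h where h: "continuous_on ({0..1} \<times> {0..1}) h"
    "h \<in> ({0..1} \<times> {0..1}) \<rightarrow> earring_plus"
    "\<And>t. t \<in> {0..1} \<Longrightarrow> h (0, t) = p t" "\<And>t. t \<in> {0..1} \<Longrightarrow> h (1, t) = q t"
    "\<And>s. s \<in> {0..1::real} \<Longrightarrow> pathstart (h \<circ> Pair s) = pathstart p \<and> pathfinish (h \<circ> Pair s) = pathfinish p"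
    using h unfolding homotopic_paths by blast
  have ends: "theta j (h (s, 0)) = 1" "theta j (h (s, 1)) = 1" if "s \<in> {0..1}" for s j
    using h(5)[OF that] p by (auto simp: pathstart_def pathfinish_def anchored_def)
  define L where "L j = (\<lambda>(s, t). circle_lift (\<lambda>t. theta j (h (s, t))) t)" for j
  have th: "continuous_on ({0..1} \<times> {0..1}) (\<lambda>(s, t). theta j (h (s, t)))" for j
    using continuous_on_compose2[OF continuous_on_theta h(1)] h(2)
    by (auto simp: case_prod_unfold image_subset_iff_funcset)
  have cp: "circle_path (\<lambda>t. theta j (h (s, t)))" if "s \<in> {0..1}" for s j
  proof -
    have "continuous_on {0..1} (\<lambda>t. case (s, t) of (s, t) \<Rightarrow> theta j (h (s, t)))"
      using that by (intro continuous_on_compose2[OF th] continuous_intros) auto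
    then show ?thesis
      using ends(1)[OF that] by (simp add: circle_path_def path_def norm_theta)
  qed
  have L: "continuous_on ({0..1} \<times> {0..1}) (L j)" for j
    unfolding L_def by (rule circle_lift_square[OF th]) (auto simp: norm_theta ends)
  have L': "cis (2 * pi * L j z) = theta j (h z)" if "z \<in> {0..1} \<times> {0..1}" for z j
    using that by (auto simp: L_def cis_circle_lift[OF cp])
  have cong: "circle_lift (\<lambda>t. theta j (h (0, t))) = position p j"
    "circle_lift (\<lambda>t. theta j (h (1, t))) = position q j" for j
    unfolding position_def by (intro circle_lift_cong; simp add: h(3,4))+
  have "circle_lift (\<lambda>t. theta j (h (0, t))) 1 = circle_lift (\<lambda>t. theta j (h (1, t))) 1"
    by (rule circle_lift_homotopy[OF th]) (auto simp: norm_theta ends)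
  then show "winding p j = winding q j"
    by (simp add: winding_def cong)
  define G where "G s t = (if \<forall>j<m. L j (s, t) = v j then theta m (h (s, t)) else 1)" for s t
  have "continuous_on ({0..1} \<times> {0..1}) (\<lambda>z. if \<forall>j<m. L j z = v j then theta m (h z) else 1)"
    using h(1,2) L L' by (intro continuous_on_gate) auto
  then have "continuous_on ({0..1} \<times> {0..1}) (\<lambda>(s, t). G s t)"
    unfolding G_def case_prod_unfold prod.collapse .
  then have "circle_lift (G 0) 1 = circle_lift (G 1) 1"
    by (rule circle_lift_homotopy) (auto simp: G_def norm_theta ends)
  moreover have "circle_lift (G 0) = circle_lift (gated p m v)"
    "circle_lift (G 1) = circle_lift (gated q m v)"
    by (intro circle_lift_cong; auto simp: G_def gated_def L_def cong h(3,4))+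
  ultimately show "crossings p m v = crossings q m v"
    by (simp add: crossings_def)
qed

lemma anchored_join:
  assumes "anchored p" "anchored q" "pathfinish p = pathstart q"
  shows "anchored (p +++ q)"
  using assms unfolding anchored_def by (auto simp: path_image_join)

lemma anchored_reversepath: "anchored p \<Longrightarrow> anchored (reversepath p)"
  unfolding anchored_def by auto

text \<open>The second path starts where the first one has arrived in the grid, hence the translation by
  \<open>winding p\<close>.\<close>

lemma crossings_join:
  assumes p: "anchored p" and q: "anchored q" and "pathfinish p = pathstart q"
  shows "winding (p +++ q) j = winding p j + winding q j"
    and "crossings (p +++ q) m v = crossings p m v + crossings q m (\<lambda>j. v j - winding p j)"
proof -
  have pos: "position (p +++ q) j t =
    (if t \<le> 1/2 then position p j (2 * t) else winding p j + position q j (2 * t - 1))"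
    if "t \<in> {0..1}" for j t
    unfolding position_def winding_def path_compose_join
    by (rule circle_lift_join[OF anchored_theta_path(1)[OF p] anchored_theta_path(1)[OF q]
      anchored_theta_path(2)[OF p] that])
  show "winding (p +++ q) j = winding p j + winding q j"
    using pos[of 1] by (simp add: winding_def)
  have "circle_lift (gated (p +++ q) m v) =
      circle_lift (gated p m v +++ gated q m (\<lambda>j. v j - winding p j))"
  proof (rule circle_lift_cong)
    fix t :: real assume t: "t \<in> {0..1}"
    show "gated (p +++ q) m v t = (gated p m v +++ gated q m (\<lambda>j. v j - winding p j)) t"
      unfolding gated_def pos[OF t] by (auto simp: joinpaths_def algebra_simps)
  qed
  then show "crossings (p +++ q) m v = crossings p m v + crossings q m (\<lambda>j. v j - winding p j)"
    using circle_lift_join[OF gated_path(1)[OF p] gated_path(1)[OF q] gated_path(2)[OF p], of 1]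
    by (simp add: crossings_def)
qed

lemma crossings_trivial:
  assumes "\<And>j t. t \<in> {0..1} \<Longrightarrow> theta j (p t) = 1"
  shows "winding p j = 0" "crossings p m v = 0"
  using assms crossings_support[of p m v]
  by (auto simp: winding_def position_def intro!: circle_lift_const)

lemma crossings_reversepath:
  assumes p: "anchored p"
  shows "winding (reversepath p) j = - winding p j"
    and "crossings (reversepath p) m v = - crossings p m (\<lambda>j. v j + winding p j)"
proof -
  have h: "homotopic_paths earring_plus (p +++ reversepath p) (linepath (pathstart p) (pathstart p))"
    using p by (intro homotopic_paths_rinv) (auto simp: anchored_def)
  have a: "anchored (p +++ reversepath p)"
    using p by (intro anchored_join anchored_reversepath) auto
  have triv: "theta j (linepath (pathstart p) (pathstart p) t) = 1" for j t
    using p by (simp add: linepath_refl anchored_def)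
  note hom = crossings_homotopic[OF h a]
  note join = crossings_join[OF p anchored_reversepath[OF p], unfolded pathstart_reversepath, OF refl]
  have "winding p j + winding (reversepath p) j = 0"
    using hom(1)[of j] join(1)[of j] crossings_trivial(1)[OF triv] by simp
  then show "winding (reversepath p) j = - winding p j"
    by simp
  have "crossings p m w + crossings (reversepath p) m (\<lambda>j. w j - winding p j) = 0" for w
    using hom(2)[of m w] join(2)[of m w] crossings_trivial(2)[OF triv] by simp
  from this[of "\<lambda>j. v j + winding p j"]
  show "crossings (reversepath p) m v = - crossings p m (\<lambda>j. v j + winding p j)"
    by simp
qed

text \<open>Written additively with translations as multipliers, \<open>D(a p a\<^sup>-) = (1 - B) D(a) + A D(p)\<close>, where
  \<open>A\<close> and \<open>B\<close> stand for the windings of \<open>a\<close> and \<open>p\<close>.\<close>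

lemma crossings_conjugate:
  assumes "anchored a" "anchored p" "pathfinish a = pathstart p" "pathfinish p = pathstart p"
  shows "crossings (a +++ p +++ reversepath a) m v =
    crossings a m v + crossings p m (\<lambda>j. v j - winding a j) - crossings a m (\<lambda>j. v j - winding p j)"
proof -
  have b: "anchored (p +++ reversepath a)"
    using assms by (intro anchored_join anchored_reversepath) auto
  show ?thesis
    using assms b
    by (simp add: crossings_join crossings_reversepath anchored_reversepath algebra_simps)
qed

lemma position_bounded:
  assumes "anchored p"
  obtains M where "\<And>t. t \<in> {0..1} \<Longrightarrow> \<bar>position p j t\<bar> \<le> M"
proof -
  have "compact (position p j ` {0..1})"
    unfolding position_def
    by (intro compact_continuous_image circle_lift anchored_theta_path assms) auto
  then show ?thesis
    using that compact_imp_bounded[of "position p j ` {0..1}"] unfolding bounded_iff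
    by (metis image_eqI real_norm_def)
qed

text \<open>A coordinate that never passes the point opposite to \<open>b0\<close> stays within half a turn of its start, and
  the only integer in that range is \<open>0\<close>.\<close>

lemma crossings_small:
  assumes p: "anchored p"
    and small: "\<And>j t. \<lbrakk>j \<le> k; t \<in> {0..1}\<rbrakk> \<Longrightarrow> theta j (p t) \<noteq> -1"
  shows winding_small: "j \<le> k \<Longrightarrow> winding p j = 0"
    and "m \<le> k \<Longrightarrow> crossings p m v = 0"
    and "\<lbrakk>crossings p m v \<noteq> 0; j \<le> k; j < m\<rbrakk> \<Longrightarrow> v j = 0"
proof -
  have pos: "\<bar>position p j t\<bar> < 1/2" if "j \<le> k" "t \<in> {0..1}" for j t
    unfolding position_def using small[OF that(1)]
    by (intro circle_lift_small anchored_theta_path p that) auto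
  show "winding p j = 0" if "j \<le> k"
  proof (rule small_Ints_zero)
    show "winding p j \<in> \<int>"
      unfolding winding_def position_def by (intro circle_lift_1_Ints anchored_theta_path p)
    show "\<bar>winding p j\<bar> < 1/2"
      using pos[OF that, of 1] by (simp add: winding_def)
  qed
  show "crossings p m v = 0" if "m \<le> k"
  proof (rule small_Ints_zero)
    show "crossings p m v \<in> \<int>"
      unfolding crossings_def by (intro circle_lift_1_Ints gated_path p)
    have "gated p m v t \<noteq> -1" if "t \<in> {0..1}" for t
      using small[OF \<open>m \<le> k\<close> that] by (simp add: gated_def)
    then show "\<bar>crossings p m v\<bar> < 1/2"
      unfolding crossings_def by (intro circle_lift_small gated_path p) auto
  qed
  show "v j = 0" if nz: "crossings p m v \<noteq> 0" "j \<le> k" "j < m"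
  proof -
    obtain t where t: "t \<in> {0..1}" "position p j t = v j" "theta m (p t) \<noteq> 1"
      using crossings_support[OF nz(1)] nz(3) by metis
    then have "theta j (p t) = 1"
      using theta_neq_1_unique[of j "p t" m] nz(3) by auto
    then have "v j \<in> \<int>"
      using cis_circle_lift[OF anchored_theta_path(1)[OF p], of t j] t
      by (simp add: position_def cis_2pi_eq_1_iff)
    then show ?thesis
      using small_Ints_zero pos[OF nz(2) t(1)] t(2) by simp
  qed
qed


section \<open>Loops with countably many visited points\<close>

text \<open>A requirement for infinitely many \<open>m\<close>, rather than for all of them, makes the set of a product a
  subset of the union of the (translated) sets of the factors: if a sum is nonzero infinitely often,
  then so is one of the summands.\<close>

definition frequent :: "(nat \<Rightarrow> (nat \<Rightarrow> real) \<Rightarrow> real) \<Rightarrow> (nat \<Rightarrow> real) set" where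
  "frequent E = {v. \<exists>\<^sub>F m in sequentially. E m v \<noteq> 0}"

abbreviation visited :: "(real \<Rightarrow> plane) \<Rightarrow> (nat \<Rightarrow> real) set" where
  "visited p \<equiv> frequent (crossings p)"

lemma frequent_trivial:
  assumes "\<And>m v. m > n \<Longrightarrow> E m v = 0"
  shows "frequent E = {}"
proof -
  have "\<forall>\<^sub>F m in sequentially. \<not> E m v \<noteq> 0" for v
    using assms by (auto simp: eventually_sequentially intro!: exI[of _ "Suc n"])
  then show ?thesis
    unfolding frequent_def frequently_def by auto
qed

lemma countable_translate:
  fixes c :: "nat \<Rightarrow> real"
  assumes "countable V"
  shows "countable {v. (\<lambda>j. v j - c j) \<in> V}"
proof -
  have "{v. (\<lambda>j. v j - c j) \<in> V} \<subseteq> (\<lambda>w j. w j + c j) ` V"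
    by (auto intro!: image_eqI)
  then show ?thesis
    using assms countable_subset countable_image by meson
qed

lemma countable_translate_iff:
  fixes c :: "nat \<Rightarrow> real"
  shows "countable {v. (\<lambda>j. v j - c j) \<in> V} \<longleftrightarrow> countable V"
proof
  assume "countable {v. (\<lambda>j. v j - c j) \<in> V}"
  from countable_translate[OF this, of "\<lambda>j. - c j"] show "countable V"
    by simp
qed (rule countable_translate)

lemma visited_join:
  assumes "anchored p" "anchored q" "pathfinish p = pathstart q"
  shows "visited (p +++ q) \<subseteq> visited p \<union> {v. (\<lambda>j. v j - winding p j) \<in> visited q}"
proof
  fix v assume "v \<in> visited (p +++ q)"
  then have "\<exists>\<^sub>F m in sequentially. crossings p m v + crossings q m (\<lambda>j. v j - winding p j) \<noteq> 0"
    by (simp add: frequent_def crossings_join[OF assms])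
  then have "\<exists>\<^sub>F m in sequentially. crossings p m v \<noteq> 0 \<or> crossings q m (\<lambda>j. v j - winding p j) \<noteq> 0"
    by (elim frequently_elim1) auto
  then show "v \<in> visited p \<union> {v. (\<lambda>j. v j - winding p j) \<in> visited q}"
    unfolding frequent_def frequently_disj_iff by blast
qed

lemma countable_visited_join:
  assumes "anchored p" "anchored q" "pathfinish p = pathstart q"
    and "countable (visited p)" "countable (visited q)"
  shows "countable (visited (p +++ q))"
  using visited_join[OF assms(1-3)] countable_translate[OF assms(5)] assms(4)
  by (meson countable_Un countable_subset)

lemma countable_visited_reversepath:
  assumes "anchored p" "countable (visited p)"
  shows "countable (visited (reversepath p))"
proof -
  have "visited (reversepath p) = {v. (\<lambda>j. v j - (- winding p j)) \<in> visited p}"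
    by (simp add: frequent_def crossings_reversepath[OF assms(1)])
  then show ?thesis
    using countable_translate[OF assms(2)] by metis
qed

lemma visited_homotopic:
  assumes "homotopic_paths earring_plus p q" "anchored p"
  shows "visited p = visited q"
  unfolding frequent_def crossings_homotopic(2)[OF assms] ..

text \<open>Here \<open>t n\<close> plays the role of the product \<open>p n \<cdot> p (n + 1) \<cdot> \<dots>\<close>. A point visited by \<open>t 0\<close> is visited
  by some factor, up to translation, or else it is visited, up to translation, by all tails. The
  tails shrink, which leaves only the endpoint of the product in the second case.\<close>

lemma countable_visited_infinite_product:
  fixes p t :: "nat \<Rightarrow> real \<Rightarrow> plane"
  assumes anchored: "\<And>n. anchored (p n)" "\<And>n. anchored (t n)"
    and ends: "\<And>n. pathfinish (p n) = pathstart (t (Suc n))"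
    and split: "\<And>n. homotopic_paths earring_plus (t n) (p n +++ t (Suc n))"
    and small: "\<And>k. \<exists>N. \<forall>n\<ge>N. \<forall>j\<le>k. \<forall>s\<in>{0..1}. theta j (t n s) \<noteq> -1"
    and ctbl: "\<And>n. countable (visited (p n))"
  shows "countable (visited (t 0))"
proof -
  define Q where "Q n j = (\<Sum>i<n. winding (p i) j)" for n j
  have w: "winding (t n) j = winding (p n) j + winding (t (Suc n)) j" for n j
    unfolding crossings_homotopic(1)[OF split[of n] anchored(2)]
    by (rule crossings_join(1)[OF anchored(1,2) ends])
  have Q: "winding (t 0) j = Q n j + winding (t n) j" for n j
  proof (induction n)
    case (Suc n)
    then show ?case
      using w[of n j] by (simp add: Q_def)
  qed (simp add: Q_def)
  have step: "visited (t n) \<subseteq> visited (p n) \<union> {v. (\<lambda>j. v j - winding (p n) j) \<in> visited (t (Suc n))}" for n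
    unfolding visited_homotopic[OF split[of n] anchored(2)]
    by (rule visited_join[OF anchored(1,2) ends])
  define A where "A = (\<Union>i. {v. (\<lambda>j. v j - Q i j) \<in> visited (p i)})"
  \<comment> \<open>peel off the first \<open>n\<close> factors; \<open>Q n\<close> is the winding of their product\<close>
  have fin: "visited (t 0) \<subseteq> A \<union> {v. (\<lambda>j. v j - Q n j) \<in> visited (t n)}" for n
  proof (induction n)
    case 0
    show ?case
      by (auto simp: Q_def)
  next
    case (Suc n)
    have "{v. (\<lambda>j. v j - Q n j) \<in> visited (t n)} \<subseteq>
        A \<union> {v. (\<lambda>j. v j - Q (Suc n) j) \<in> visited (t (Suc n))}"
    proof
      fix v assume "v \<in> {v. (\<lambda>j. v j - Q n j) \<in> visited (t n)}"
      then have "(\<lambda>j. v j - Q n j) \<in> visited (p n) \<or>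
          (\<lambda>j. v j - Q n j - winding (p n) j) \<in> visited (t (Suc n))"
        using step[of n] by auto
      then show "v \<in> A \<union> {v. (\<lambda>j. v j - Q (Suc n) j) \<in> visited (t (Suc n))}"
        by (auto simp: A_def Q_def algebra_simps)
    qed
    then show ?case
      using Suc by blast
  qed
  have "visited (t 0) \<subseteq> A \<union> {winding (t 0)}"
  proof (intro subsetI, rule ccontr)
    fix v assume v: "v \<in> visited (t 0)" "v \<notin> A \<union> {winding (t 0)}"
    then obtain j where j: "v j \<noteq> winding (t 0) j"
      by auto
    obtain n where n: "\<And>i s. i \<le> j \<Longrightarrow> s \<in> {0..1} \<Longrightarrow> theta i (t n s) \<noteq> -1"
      using small[of j] by blast
    have wj: "winding (t n) j = 0"
      by (rule winding_small[where k = j, OF anchored(2)]) (use n in auto)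
    have "(\<lambda>j. v j - Q n j) \<in> visited (t n)"
      using v fin[of n] by auto
    then obtain m where m: "m \<ge> Suc j" "crossings (t n) m (\<lambda>j. v j - Q n j) \<noteq> 0"
      unfolding frequent_def frequently_sequentially mem_Collect_eq by blast
    have "v j - Q n j = 0"
      by (rule crossings_small(3)[where k = j, OF anchored(2) _ m(2)]) (use n m(1) in auto)
    then show False
      using Q[of j n] j wj by simp
  qed
  moreover have "countable A"
    unfolding A_def by (intro countable_UN countable_translate ctbl) auto
  ultimately show ?thesis
    by (meson countable_Un countable_subset countable_finite finite.intros)
qed

text \<open>Away from the endpoint of \<open>a\<close> the crossings of \<open>p n\<close> do not contribute for large \<open>n\<close>, and
  \<open>D(a p a\<^sup>-) = (1 - B) D(a)\<close>. If \<open>B \<noteq> 0\<close>, the factor \<open>1 - B\<close> can be inverted by a geometric series,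
  which is a finite sum because \<open>a\<close> stays in a bounded range of each coordinate. So the points visited
  by \<open>a\<close> are translates of points visited by \<open>a p a\<^sup>-\<close> by multiples of \<open>B\<close>.\<close>

lemma countable_visited_conjugator:
  fixes a :: "real \<Rightarrow> plane" and p :: "nat \<Rightarrow> real \<Rightarrow> plane"
  assumes a: "anchored a" and p: "\<And>n. anchored (p n)"
    and ends: "\<And>n. pathstart (p n) = pathfinish a" "\<And>n. pathfinish (p n) = pathfinish a"
    and small: "\<And>k. \<exists>N. \<forall>n\<ge>N. \<forall>j\<le>k. \<forall>s\<in>{0..1}. theta j (p n s) \<noteq> -1"
    and freq: "\<exists>\<^sub>F n in sequentially. winding (p n) \<noteq> (\<lambda>_. 0)"
    and ctbl: "\<And>n. countable (visited (a +++ p n +++ reversepath a))"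
  shows "countable (visited a)"
proof -
  define D where "D n = crossings (a +++ p n +++ reversepath a)" for n
  have D: "D n m v = crossings a m v + crossings (p n) m (\<lambda>j. v j - winding a j) -
      crossings a m (\<lambda>j. v j - winding (p n) j)" for n m v
    unfolding D_def using a p ends by (intro crossings_conjugate) auto
  define A where "A = (\<Union>n. \<Union>i. {v. (\<lambda>j. v j - real i * winding (p n) j) \<in> frequent (D n)})"
  have "visited a \<subseteq> A \<union> {winding a}"
  proof (intro subsetI, rule ccontr)
    fix v assume v: "v \<in> visited a" "v \<notin> A \<union> {winding a}"
    then obtain j where j: "v j \<noteq> winding a j"
      by auto
    obtain N where N: "\<And>n i s. n \<ge> N \<Longrightarrow> i \<le> j \<Longrightarrow> s \<in> {0..1} \<Longrightarrow> theta i (p n s) \<noteq> -1"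
      using small[of j] by blast
    obtain n where n: "n \<ge> N" "winding (p n) \<noteq> (\<lambda>_. 0)"
      using freq unfolding frequently_sequentially by blast
    define B where "B = winding (p n)"
    have Bj: "B j = 0"
      unfolding B_def by (rule winding_small[where k = j, OF p]) (use N[OF n(1)] in auto)
    obtain l where l: "B l \<noteq> 0"
      using n(2) unfolding B_def by auto
    obtain M where M: "\<And>t. t \<in> {0..1} \<Longrightarrow> \<bar>position a l t\<bar> \<le> M"
      using position_bounded[OF a, of l] by blast
    obtain I :: nat where I: "(\<bar>v l\<bar> + M) / \<bar>B l\<bar> < real I"
      using reals_Archimedean2 by blast
    \<comment> \<open>after \<open>I\<close> steps of \<open>B\<close> the \<open>l\<close>-th coordinate is out of reach of \<open>a\<close>, whatever \<open>m\<close> is\<close>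
    have far: "crossings a m (\<lambda>j. v j - real I * B j) = 0" if "m > l" for m
    proof (rule ccontr)
      assume "\<not> ?thesis"
      then obtain t where t: "t \<in> {0..1}" "position a l t = v l - real I * B l"
        using crossings_support \<open>m > l\<close> by metis
      have "\<bar>v l\<bar> + M < real I * \<bar>B l\<bar>"
        using I l by (simp add: divide_less_eq)
      moreover have "real I * \<bar>B l\<bar> = \<bar>real I * B l\<bar>"
        by (simp add: abs_mult)
      ultimately show False
        using M[OF t(1)] t(2) by linarith
    qed
    \<comment> \<open>\<open>B j = 0\<close>, so no step of \<open>B\<close> leads to a point where \<open>p n\<close> contributes\<close>
    have tele: "crossings a m (\<lambda>j. v j - real i * B j) =
        D n m (\<lambda>j. v j - real i * B j) + crossings a m (\<lambda>j. v j - real (Suc i) * B j)"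
      if "m > j" for i m
    proof -
      have "crossings (p n) m (\<lambda>j. v j - real i * B j - winding a j) = 0"
      proof (rule ccontr)
        assume nz: "\<not> ?thesis"
        have "v j - real i * B j - winding a j = 0"
          by (rule crossings_small(3)[where k = j, OF p _ nz]) (use N[OF n(1)] \<open>m > j\<close> in auto)
        then show False
          using Bj j by simp
      qed
      then show ?thesis
        by (simp add: D B_def algebra_simps)
    qed
    have sum: "crossings a m v = (\<Sum>i<I'. D n m (\<lambda>j. v j - real i * B j)) +
        crossings a m (\<lambda>j. v j - real I' * B j)" if "m > j" for m I'
      by (induction I') (use tele[OF that] in auto)
    have "\<exists>\<^sub>F m in sequentially. crossings a m v \<noteq> 0 \<and> m > max j l"
      using v(1) unfolding frequent_def
      by (intro frequently_eventually_frequently eventually_gt_at_top) simp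
    \<comment> \<open>the bound \<open>I\<close> does not depend on \<open>m\<close>, so one index \<open>i\<close> occurs for infinitely many \<open>m\<close>\<close>
    then have "\<exists>\<^sub>F m in sequentially. \<exists>i\<in>{..<I}. D n m (\<lambda>j. v j - real i * B j) \<noteq> 0"
    proof (rule frequently_elim1)
      fix m assume m: "crossings a m v \<noteq> 0 \<and> m > max j l"
      then have "(\<Sum>i<I. D n m (\<lambda>j. v j - real i * B j)) \<noteq> 0"
        using sum[of m I] far[of m] by auto
      then show "\<exists>i\<in>{..<I}. D n m (\<lambda>j. v j - real i * B j) \<noteq> 0"
        by (meson sum.neutral)
    qed
    then obtain i where "(\<lambda>j. v j - real i * B j) \<in> frequent (D n)"
      using eventually_ball_finite[of "{..<I}" "\<lambda>m i. D n m (\<lambda>j. v j - real i * B j) = 0" sequentially]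
      unfolding frequent_def frequently_def by auto
    then show False
      using v(2) unfolding A_def B_def by blast
  qed
  moreover have "countable A"
    unfolding A_def using ctbl by (intro countable_UN countable_translate) (auto simp: D_def)
  ultimately show ?thesis
    by (meson countable_Un countable_subset countable_finite finite.intros)
qed

text \<open>Either infinitely many \<open>p n\<close> have nonzero winding, and then the conjugator \<open>a\<close> and all \<open>p n\<close> visit
  only countably many points, or from some \<open>N\<close> on all windings vanish, and then conjugation by \<open>a\<close>
  is a mere translation. In the second case only the tail from \<open>N\<close> on can be treated in this way.\<close>

lemma countable_visited_conjugate_infinite_product:
  fixes p t :: "nat \<Rightarrow> real \<Rightarrow> plane"
  assumes a: "anchored a" and anch: "\<And>n. anchored (p n)" "\<And>n. anchored (t n)"
    and ends: "\<And>n. pathstart (p n) = pathfinish a" "\<And>n. pathfinish (p n) = pathfinish a"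
      "\<And>n. pathstart (t n) = pathfinish a" "\<And>n. pathfinish (t n) = pathfinish a"
    and split: "\<And>n. homotopic_paths earring_plus (t n) (p n +++ t (Suc n))"
    and small: "\<And>k. \<exists>N. \<forall>n\<ge>N. \<forall>j\<le>k. \<forall>s\<in>{0..1}. theta j (p n s) \<noteq> -1"
      "\<And>k. \<exists>N. \<forall>n\<ge>N. \<forall>j\<le>k. \<forall>s\<in>{0..1}. theta j (t n s) \<noteq> -1"
    and ctbl: "\<And>n. countable (visited (a +++ p n +++ reversepath a))"
  obtains n where "countable (visited (a +++ t n +++ reversepath a))"
proof (cases "\<exists>\<^sub>F n in sequentially. winding (p n) \<noteq> (\<lambda>_. 0)")
  case True
  have ca: "countable (visited a)"
    by (rule countable_visited_conjugator[OF a anch(1) ends(1,2) small(1) True ctbl])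
  have cr: "countable (visited (reversepath a))"
    by (rule countable_visited_reversepath[OF a ca])
  have "countable (visited (p n))" for n
  proof -
    let ?c = "a +++ p n +++ reversepath a"
    have "{v. (\<lambda>j. v j - winding a j) \<in> visited (p n)} \<subseteq>
        visited ?c \<union> visited a \<union> {v. (\<lambda>j. v j - winding (p n) j) \<in> visited a}"
    proof
      fix v assume "v \<in> {v. (\<lambda>j. v j - winding a j) \<in> visited (p n)}"
      then have "\<exists>\<^sub>F m in sequentially. crossings (p n) m (\<lambda>j. v j - winding a j) \<noteq> 0"
        by (simp add: frequent_def)
      then have "\<exists>\<^sub>F m in sequentially. crossings ?c m v \<noteq> 0 \<or> crossings a m v \<noteq> 0 \<or>
          crossings a m (\<lambda>j. v j - winding (p n) j) \<noteq> 0"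
        by (rule frequently_elim1) (use crossings_conjugate[OF a anch(1)] ends in auto)
      then show "v \<in> visited ?c \<union> visited a \<union> {v. (\<lambda>j. v j - winding (p n) j) \<in> visited a}"
        unfolding frequent_def frequently_disj_iff by blast
    qed
    then have "countable {v. (\<lambda>j. v j - winding a j) \<in> visited (p n)}"
      using ctbl ca countable_translate by (meson countable_Un countable_subset)
    then show ?thesis
      by (simp add: countable_translate_iff)
  qed
  then have "countable (visited (t 0))"
    using countable_visited_infinite_product[OF anch _ split small(2)] ends by simp
  then have "countable (visited (a +++ t 0 +++ reversepath a))"
    using a anch ends ca cr
    by (intro countable_visited_join anchored_join anchored_reversepath) auto
  then show ?thesis
    using that by blast
next
  case False
  then obtain N where N: "\<And>n. n \<ge> N \<Longrightarrow> winding (p n) = (\<lambda>_. 0)"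
    unfolding frequently_sequentially by blast
  have conj: "countable (visited (a +++ q +++ reversepath a)) \<longleftrightarrow> countable (visited q)"
    if q: "anchored q" "pathstart q = pathfinish a" "pathfinish q = pathfinish a"
      "winding q = (\<lambda>_. 0)" for q
  proof -
    have "visited (a +++ q +++ reversepath a) = {v. (\<lambda>j. v j - winding a j) \<in> visited q}"
      using crossings_conjugate[OF a q(1)] q by (simp add: frequent_def)
    then show ?thesis
      by (simp add: countable_translate_iff)
  qed
  have w: "winding (t N) j = winding (t (N + n)) j" for n j
  proof (induction n)
    case (Suc n)
    have "winding (t (N + n)) j = winding (p (N + n)) j + winding (t (Suc (N + n))) j"
      unfolding crossings_homotopic(1)[OF split[of "N + n"] anch(2)]
      by (rule crossings_join(1)[OF anch(1,2)]) (simp add: ends)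
    then show ?case
      using Suc N[of "N + n"] by simp
  qed simp
  have "winding (t N) j = 0" for j
  proof -
    obtain N' where N': "\<And>n i s. n \<ge> N' \<Longrightarrow> i \<le> j \<Longrightarrow> s \<in> {0..1} \<Longrightarrow> theta i (t n s) \<noteq> -1"
      using small(2)[of j] by blast
    have "winding (t (N + N')) j = 0"
      using N' by (intro winding_small[OF anch(2), of j]) auto
    then show ?thesis
      using w by simp
  qed
  then have wt: "winding (t N) = (\<lambda>_. 0)"
    by auto
  have "countable (visited (t (N + 0)))"
  proof (rule countable_visited_infinite_product[where p = "\<lambda>n. p (N + n)" and t = "\<lambda>n. t (N + n)"])
    show "countable (visited (p (N + n)))" for n
      using conj[OF anch(1) ends(1,2) N] ctbl by auto
    show "homotopic_paths earring_plus (t (N + n)) (p (N + n) +++ t (N + Suc n))" for n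
      using split[of "N + n"] by simp
    show "\<exists>M. \<forall>n\<ge>M. \<forall>j\<le>k. \<forall>s\<in>{0..1}. theta j (t (N + n) s) \<noteq> -1" for k
      using small(2)[of k] by (meson trans_le_add2)
  qed (use anch ends in auto)
  then show ?thesis
    using that conj[OF anch(2) ends(3,4) wt] by simp
qed


section \<open>The subgroup of classes with countably many visited points\<close>

definition scattered_classes :: "(real \<Rightarrow> plane) set set" where
  "scattered_classes =
     path_class earring_plus ` {p \<in> based_loops earring_plus b0_plus. countable (visited p)}"

lemma theta_b0_plus: "theta j b0_plus = 1"
  by (simp add: b0_plus_def theta_whisker)

lemma b0_plus_in: "b0_plus \<in> earring_plus"
  by (simp add: b0_plus_def earring_plus_def)

lemma b0_in: "b0 \<in> earring_plus"
  by (simp add: b0_def earring_plus_def)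

lemma based_loops_anchored: "p \<in> based_loops earring_plus b0_plus \<Longrightarrow> anchored p"
  by (auto simp: based_loops_def anchored_def theta_b0_plus)

text \<open>Membership can be tested on any representative, since \<open>visited\<close> is homotopy invariant.\<close>

lemma path_class_scattered_iff:
  assumes "p \<in> based_loops earring_plus b0_plus"
  shows "path_class earring_plus p \<in> scattered_classes \<longleftrightarrow> countable (visited p)"
proof
  assume "path_class earring_plus p \<in> scattered_classes"
  then obtain q where q: "q \<in> based_loops earring_plus b0_plus" "countable (visited q)"
    "path_class earring_plus p = path_class earring_plus q"
    unfolding scattered_classes_def by blast
  then have "homotopic_paths earring_plus p q"
    using path_class_eq_iff by metis
  then show "countable (visited p)"
    using q(2) visited_homotopic based_loops_anchored[OF assms] by metis
qed (use assms in \<open>auto simp: scattered_classes_def\<close>)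

lemma subgroup_scattered_classes:
  "subgroup scattered_classes (fundamental_group earring_plus b0_plus)"
proof -
  let ?G = "fundamental_group earring_plus b0_plus"
  interpret group ?G
    by (rule group_fundamental_group[OF b0_plus_in])
  show ?thesis
  proof (rule subgroupI)
    show "scattered_classes \<subseteq> carrier ?G"
      by (auto simp: scattered_classes_def carrier_fundamental_group)
    have "visited (\<lambda>_. b0_plus) = {}"
      by (rule frequent_trivial) (simp add: crossings_trivial theta_b0_plus)
    then show "scattered_classes \<noteq> {}"
      using path_class_scattered_iff[OF based_loops_const[OF b0_plus_in]] by auto
  next
    fix A assume "A \<in> scattered_classes"
    then obtain p where p: "p \<in> based_loops earring_plus b0_plus" "countable (visited p)"
      "A = path_class earring_plus p"
      unfolding scattered_classes_def by blast
    note r = based_loops_reverse[OF p(1)]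
    have "path_class earring_plus (reversepath p) \<otimes>\<^bsub>?G\<^esub> A = \<one>\<^bsub>?G\<^esub>"
      unfolding p(3) mult_path_class[OF r p(1)] one_fundamental_group
      by (rule path_class_eqI[OF homotopic_linv[OF p(1)]])
    then have "inv\<^bsub>?G\<^esub> A = path_class earring_plus (reversepath p)"
      using p r by (intro inv_equality) (auto simp: carrier_fundamental_group)
    then show "inv\<^bsub>?G\<^esub> A \<in> scattered_classes"
      using path_class_scattered_iff[OF r] countable_visited_reversepath p based_loops_anchored
      by metis
  next
    fix A B assume "A \<in> scattered_classes" "B \<in> scattered_classes"
    then obtain p q where p: "p \<in> based_loops earring_plus b0_plus" "countable (visited p)"
      "A = path_class earring_plus p"
      and q: "q \<in> based_loops earring_plus b0_plus" "countable (visited q)"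
      "B = path_class earring_plus q"
      unfolding scattered_classes_def by blast
    have "countable (visited (p +++ q))"
      using p q by (intro countable_visited_join based_loops_anchored) (auto simp: based_loops_def)
    then show "A \<otimes>\<^bsub>?G\<^esub> B \<in> scattered_classes"
      unfolding p(3) q(3) mult_path_class[OF p(1) q(1)]
      using path_class_scattered_iff[OF based_loops_join[OF p(1) q(1)]] by simp
  qed
qed

lemma path_whisker: "path whisker" "pathstart whisker = b0_plus" "pathfinish whisker = b0"
  "path_image whisker \<subseteq> earring_plus"
  by (auto simp: path_def whisker_def b0_plus_def b0_def pathstart_def pathfinish_def
      path_image_def earring_plus_def intro!: continuous_intros)

lemma theta_whisker_path: "t \<in> {0..1} \<Longrightarrow> theta j (whisker t) = 1"
  by (simp add: whisker_def theta_whisker)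

lemma anchored_whisker: "anchored whisker"
  using path_whisker by (simp add: anchored_def theta_b0_plus)

lemma conj_based_loop:
  assumes "p \<in> based_loops S x" "path a" "path_image a \<subseteq> S" "pathfinish a = x"
  shows "a +++ p +++ reversepath a \<in> based_loops S (pathstart a)"
  using assms by (auto simp: based_loops_def path_image_join)

lemma ell_based_loop: "n \<ge> 1 \<Longrightarrow> ell n \<in> based_loops earring_plus b0"
  using ell_in_earring_plus
  by (auto simp: based_loops_def path_def continuous_on_ell path_image_def pathstart_def
      pathfinish_def ell_0 ell_1)

lemma c_fin_scattered:
  assumes "n \<ge> 1"
  shows "c_fin n \<in> scattered_classes"
proof -
  let ?w = "reversepath whisker"
  have ends: "pathstart (ell n) = b0" "pathfinish (ell n) = b0"
    using ell_based_loop[OF assms] by (auto simp: based_loops_def)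
  have el: "anchored (ell n)"
    using ell_based_loop[OF assms] by (auto simp: anchored_def based_loops_def)
  have "visited whisker = {}"
    by (rule frequent_trivial[where n = 0]) (rule crossings_trivial(2), rule theta_whisker_path)
  then have w: "countable (visited whisker)"
    by simp
  have "crossings (ell n) m v = 0" if "m > n" for m v
  proof (rule ccontr)
    assume "\<not> ?thesis"
    then obtain t where "theta m (ell n t) \<noteq> 1"
      using crossings_support by metis
    then show False
      using theta_ell_other[OF assms, of m t] that by auto
  qed
  then have "visited (ell n) = {}"
    by (rule frequent_trivial)
  then have e: "countable (visited (ell n))"
    by simp
  have "countable (visited (whisker +++ ell n +++ ?w))"
    using w e el anchored_whisker path_whisker(3) ends
    by (intro countable_visited_join anchored_join countable_visited_reversepath anchored_reversepath)
      auto
  then show ?thesis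
    using conj_based_loop[OF ell_based_loop[OF assms] path_whisker(1,4,3)]
    by (simp add: c_fin_def whisker_class_def path_class_scattered_iff path_whisker(2))
qed

lemma C_fin_scattered: "C_fin \<subseteq> scattered_classes"
  unfolding C_fin_def
  by (intro group.generate_subgroup_incl[OF group_fundamental_group[OF b0_plus_in]]
      subgroup_scattered_classes) (auto intro: c_fin_scattered)

lemma c_fin_in_C_fin: "n \<ge> 1 \<Longrightarrow> c_fin n \<in> C_fin"
  unfolding C_fin_def by (auto intro: generate.incl)

section \<open>The infinite concatenation and its tails\<close>

lemma insert_loops_eqI:
  assumes "\<exists>i\<in>J. t \<in> {a i..b i}"
    and "\<And>i. i \<in> J \<Longrightarrow> t \<in> {a i..b i} \<Longrightarrow> p i ((t - a i) / (b i - a i)) = y"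
  shows "insert_loops x J a b p t = y"
proof -
  define i where "i = (SOME i. i \<in> J \<and> t \<in> {a i..b i})"
  have "i \<in> J \<and> t \<in> {a i..b i}"
    unfolding i_def by (rule someI_ex) (use assms(1) in blast)
  then show ?thesis
    using assms(2)[of i] assms(1) unfolding insert_loops_def i_def[symmetric] Let_def by auto
qed

lemma insert_loops_cases:
  obtains (inside) i where "i \<in> J" "t \<in> {a i..b i}" "insert_loops x J a b p t = p i ((t - a i) / (b i - a i))"
    | (outside) "\<And>i. i \<in> J \<Longrightarrow> t \<notin> {a i..b i}" "insert_loops x J a b p t = x"
proof (cases "\<exists>i\<in>J. t \<in> {a i..b i}")
  case True
  define i where "i = (SOME i. i \<in> J \<and> t \<in> {a i..b i})"
  have "i \<in> J \<and> t \<in> {a i..b i}"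
    unfolding i_def by (rule someI_ex) (use True in blast)
  moreover have "insert_loops x J a b p t = p i ((t - a i) / (b i - a i))"
    using True unfolding insert_loops_def i_def[symmetric] Let_def by auto
  ultimately show ?thesis
    using inside by blast
next
  case False
  then have "insert_loops x J a b p t = x"
    unfolding insert_loops_def by (rule if_not_P)
  then show ?thesis
    using outside False by blast
qed

lemma ell_inf_cases:
  obtains (inside) i s where "i \<ge> 1" "t \<le> real i / (real i + 1)" "ell_inf t = ell i s"
    | (outside) "ell_inf t = b0"
  by (rule insert_loops_cases[where x = b0 and J = "{1..}" and t = t and p = ell and
        a = "\<lambda>n. (real n - 1) / real n" and b = "\<lambda>n. real n / (real n + 1)"])
    (auto simp: ell_inf_def)

lemma frac_le_frac_Suc: "real n / (real n + 1) \<le> real j / (real j + 1) \<longleftrightarrow> n \<le> j"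
  by (simp add: field_simps)

text \<open>The intervals overlap in endpoints; there both candidates for the value are \<open>b0\<close>.\<close>

lemma ell_inf_eq:
  assumes "t \<in> {real n / (real n + 1)..(real n + 1) / (real n + 2)}"
  shows "ell_inf t = ell (Suc n) ((t - real n / (real n + 1)) / ((real n + 1) / (real n + 2) - real n / (real n + 1)))"
proof -
  let ?a = "\<lambda>n. real n / (real n + 1)"
  let ?r = "\<lambda>n. (t - ?a n) / (?a (Suc n) - ?a n)"
  have pos: "?a (Suc i) - ?a i > 0" for i
    by (simp add: field_simps add_pos_nonneg)
  have overlap: "ell (Suc i) (?r i) = ell (Suc k) (?r k)"
    if "i < k" "t \<in> {?a i..?a (Suc i)}" "t \<in> {?a k..?a (Suc k)}" for i k
  proof -
    have "?a (Suc i) \<le> ?a k"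
      using that(1) by (simp add: frac_le_frac_Suc del: of_nat_Suc)
    then have "t = ?a (Suc i)" "t = ?a k"
      using that by auto
    then have "?r i = 1" "?r k = 0"
      using pos[of i] by auto
    then show ?thesis
      by (simp only: ell_0 ell_1)
  qed
  have Suc: "?a (Suc n) = (real n + 1) / (real n + 2)"
    by (simp add: add.commute)
  have t: "t \<in> {?a n..?a (Suc n)}"
    using assms unfolding Suc .
  have "ell_inf t = ell (Suc n) (?r n)"
    unfolding ell_inf_def
  proof (rule insert_loops_eqI)
    show "\<exists>i\<in>{1..}. t \<in> {(real i - 1) / real i..real i / (real i + 1)}"
      by (rule bexI[of _ "Suc n"]) (use t in \<open>auto simp: add.commute\<close>)
    fix i :: nat assume i: "i \<in> {1..}" "t \<in> {(real i - 1) / real i..real i / (real i + 1)}"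
    then obtain k where k: "i = Suc k"
      by (cases i) auto
    have tk: "t \<in> {?a k..?a (Suc k)}"
      using i by (simp add: k add.commute)
    have "ell (Suc k) (?r k) = ell (Suc n) (?r n)"
      using overlap[OF _ t tk] overlap[OF _ tk t] by (metis linorder_neqE_nat)
    then show "ell i ((t - (real i - 1) / real i) / (real i / (real i + 1) - (real i - 1) / real i)) =
        ell (Suc n) (?r n)"
      by (simp add: k add.commute)
  qed
  then show ?thesis
    unfolding Suc .
qed

lemma ell_small: "dist (ell n t) b0 \<le> 3 / real n"
proof -
  have "dist (ell n t) b0 \<le> \<bar>1 / real n + cos (pi + 2 * pi * t) / real n\<bar> + \<bar>sin (pi + 2 * pi * t) / real n\<bar>"
    unfolding b0_def ell_def dist_norm by (simp add: norm_Pair_le order.trans[OF norm_Pair_le])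
  also have "\<dots> \<le> (1 / real n + 1 / real n) + 1 / real n"
  proof (intro add_mono order.trans[OF abs_triangle_ineq])
    show "\<bar>1 / real n\<bar> \<le> 1 / real n"
      by simp
    show "\<bar>cos (pi + 2 * pi * t) / real n\<bar> \<le> 1 / real n" "\<bar>sin (pi + 2 * pi * t) / real n\<bar> \<le> 1 / real n"
      unfolding abs_divide abs_of_nat by (intro divide_right_mono abs_cos_le_one abs_sin_le_one; simp)+
  qed
  also have "\<dots> = 3 / real n"
    by (simp add: add_divide_distrib[symmetric])
  finally show ?thesis .
qed

lemma ell_inf_small:
  assumes "n \<ge> 1" "t \<ge> real n / (real n + 1)"
  shows "dist (ell_inf t) b0 \<le> 3 / real n"
proof (cases rule: ell_inf_cases[of t])
  case (inside i s)
  then have "real n / (real n + 1) \<le> real i / (real i + 1)"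
    using assms(2) by simp
  then have "n \<le> i"
    by (simp add: frac_le_frac_Suc)
  then have "3 / real i \<le> 3 / real n"
    using assms(1) by (simp add: frac_le)
  then show ?thesis
    unfolding inside(3) using ell_small order.trans by blast
qed simp

lemma ell_inf_in_earring_plus: "ell_inf t \<in> earring_plus"
  by (cases rule: ell_inf_cases[of t]) (auto simp: ell_in_earring_plus b0_in)

lemma ell_inf_1: "ell_inf 1 = b0"
  by (cases rule: ell_inf_cases[of 1]) auto

lemma ell_inf_joint: "ell_inf (real n / (real n + 1)) = b0"
proof -
  have "real n / (real n + 1) \<le> (real n + 1) / (real n + 2)"
    by (simp add: field_simps)
  then show ?thesis
    by (subst ell_inf_eq[of _ n]) (auto simp: ell_0)
qed

lemma continuous_on_ell_inf_initial: "continuous_on {0..real n / (real n + 1)} ell_inf"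
proof (induction n)
  case (Suc n)
  let ?a = "real n / (real n + 1)" and ?b = "(real n + 1) / (real n + 2)"
  have ab: "0 \<le> ?a" "?a \<le> ?b"
    by (simp_all add: field_simps)
  have "continuous_on {?a..?b} (\<lambda>t. ell (Suc n) ((t - ?a) / (?b - ?a)))"
  proof (rule continuous_on_compose2[OF continuous_on_ell[of UNIV]])
    have "?b - ?a > 0"
      by (simp add: field_simps add_pos_nonneg)
    then show "continuous_on {?a..?b} (\<lambda>t. (t - ?a) / (?b - ?a))"
      by (intro continuous_intros) auto
  qed auto
  then have "continuous_on {?a..?b} ell_inf"
    by (rule continuous_on_cong[THEN iffD1, rotated 2]) (auto simp: ell_inf_eq)
  then have "continuous_on ({0..?a} \<union> {?a..?b}) ell_inf"
    by (intro continuous_on_closed_Un Suc) auto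
  then show ?case
    using ab by (simp add: ivl_disj_un_two_touch add.commute)
qed simp

lemma path_ell_inf: "path ell_inf"
  unfolding path_def continuous_on_eq_continuous_within
proof
  fix t :: real assume t: "t \<in> {0..1}"
  show "continuous (at t within {0..1}) ell_inf"
  proof (cases "t = 1")
    case False
    obtain n where n: "1 / (1 - t) < real n"
      using reals_Archimedean2 by blast
    then have "1 < real n * (1 - t)"
      using False t by (simp add: divide_less_eq)
    then have tn: "t < real n / (real n + 1)"
      using t by (simp add: field_simps)
    have "at t within {0..1} = at t within {0..real n / (real n + 1)}"
    proof (rule at_within_nhd[of t "{..<real n / (real n + 1)}"])
      have "s \<le> 1" if "s < real n / (real n + 1)" for s
        by (rule order.trans[OF less_imp_le[OF that]]) simp
      then show "{0..1} \<inter> {..<real n / (real n + 1)} - {t} =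
          {0..real n / (real n + 1)} \<inter> {..<real n / (real n + 1)} - {t}"
        by auto
    qed (use tn in auto)
    then show ?thesis
      using continuous_on_ell_inf_initial[of n] tn t by (simp add: continuous_on_eq_continuous_within)
  next
    case True
    show ?thesis
      unfolding continuous_within_eps_delta
    proof (intro allI impI)
      fix e :: real assume "e > 0"
      obtain n :: nat where n: "3 / e < real n"
        using reals_Archimedean2 by blast
      moreover have "3 / e > 0"
        using \<open>e > 0\<close> by simp
      ultimately have n1: "n \<ge> 1"
        by (cases n) auto
      have ne: "3 / real n < e"
        using n n1 \<open>e > 0\<close> by (simp add: field_simps)
      show "\<exists>d>0. \<forall>s\<in>{0..1}. dist s t < d \<longrightarrow> dist (ell_inf s) (ell_inf t) < e"
      proof (intro exI[of _ "1 - real n / (real n + 1)"] conjI ballI impI)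
        fix s assume "s \<in> {0..1}" "dist s t < 1 - real n / (real n + 1)"
        then have "s \<ge> real n / (real n + 1)"
          by (simp add: True dist_real_def)
        then show "dist (ell_inf s) (ell_inf t) < e"
          using ell_inf_small[OF n1, of s] ne by (simp add: True ell_inf_1)
      qed simp
    qed
  qed
qed

text \<open>The concatenation of the loops \<open>ell i\<close> with \<open>i > n\<close>.\<close>

definition ell_tail :: "nat \<Rightarrow> real \<Rightarrow> plane" where
  "ell_tail n = subpath (real n / (real n + 1)) 1 ell_inf"

lemma ell_tail_0: "ell_tail 0 = ell_inf"
  by (simp add: ell_tail_def subpath_def)

lemma ell_tail_based_loop: "ell_tail n \<in> based_loops earring_plus b0"
proof -
  have "path (ell_tail n)"
    unfolding ell_tail_def by (intro path_subpath path_ell_inf) auto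
  then show ?thesis
    using ell_inf_in_earring_plus ell_inf_1 ell_inf_joint[of n]
    unfolding based_loops_def by (auto simp: ell_tail_def path_image_def subpath_def pathstart_def pathfinish_def)
qed

lemma ell_tail_small:
  assumes "n \<ge> 1" "t \<in> {0..1}"
  shows "dist (ell_tail n t) b0 \<le> 3 / real n"
  unfolding ell_tail_def subpath_def using assms
  by (intro ell_inf_small) auto

lemma ell_tail_split: "homotopic_paths earring_plus (ell_tail n) (ell (Suc n) +++ ell_tail (Suc n))"
proof -
  let ?a = "real n / (real n + 1)" and ?b = "(real n + 1) / (real n + 2)"
  have ab: "?a \<le> ?b" "?b \<le> 1" "0 \<le> ?a"
    by (simp_all add: field_simps)
  have d: "?b - ?a > 0"
    by (simp add: field_simps add_pos_nonneg)
  have im: "path_image ell_inf \<subseteq> earring_plus"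
    using ell_inf_in_earring_plus by (auto simp: path_image_def)
  have tail: "ell_tail (Suc n) = subpath ?b 1 ell_inf"
    by (simp add: ell_tail_def add.commute)
  have "homotopic_paths earring_plus (subpath ?a ?b ell_inf +++ ell_tail (Suc n)) (ell_tail n)"
    unfolding tail unfolding ell_tail_def using ab
    by (intro homotopic_join_subpaths1 path_ell_inf im) auto
  moreover have "homotopic_paths earring_plus (ell (Suc n) +++ ell_tail (Suc n))
      (subpath ?a ?b ell_inf +++ ell_tail (Suc n))"
  proof (rule homotopic_paths_join)
    show "homotopic_paths earring_plus (ell (Suc n)) (subpath ?a ?b ell_inf)"
    proof (rule homotopic_paths_eq)
      fix t :: real assume t: "t \<in> {0..1}"
      have "0 \<le> (?b - ?a) * t" "(?b - ?a) * t \<le> (?b - ?a) * 1"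
        using d t by (intro mult_nonneg_nonneg mult_left_mono; simp)+
      then have "(?b - ?a) * t + ?a \<in> {?a..?b}"
        by auto
      then show "ell (Suc n) t = subpath ?a ?b ell_inf t"
        unfolding subpath_def using d by (subst ell_inf_eq) auto
    qed (use ell_based_loop[of "Suc n"] in \<open>auto simp: based_loops_def\<close>)
    show "homotopic_paths earring_plus (ell_tail (Suc n)) (ell_tail (Suc n))"
      using ell_tail_based_loop[of "Suc n"] by (simp add: based_loops_def)
    show "pathfinish (ell (Suc n)) = pathstart (ell_tail (Suc n))"
      using ell_tail_based_loop[of "Suc n"] by (simp add: based_loops_def pathfinish_def ell_1)
  qed
  ultimately show ?thesis
    using homotopic_paths_trans homotopic_paths_sym by blast
qed

section \<open>Closedness of the subgroup\<close>

lemma conj_homotopic: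
  assumes "homotopic_paths S p q" "p \<in> based_loops S x" "path a" "path_image a \<subseteq> S" "pathfinish a = x"
  shows "homotopic_paths S (a +++ p +++ reversepath a) (a +++ q +++ reversepath a)"
  using assms homotopic_paths_imp_pathfinish[OF assms(1)]
  by (intro homotopic_paths_join) (auto simp: based_loops_def)

lemma conj_mult:
  fixes p q a :: "real \<Rightarrow> 'a::real_normed_vector"
  assumes p: "p \<in> based_loops S x" and q: "q \<in> based_loops S x"
    and a: "path a" "path_image a \<subseteq> S" "pathfinish a = x"
  shows "path_class S (a +++ p +++ reversepath a) \<otimes>\<^bsub>fundamental_group S (pathstart a)\<^esub>
      path_class S (a +++ q +++ reversepath a) = path_class S (a +++ (p +++ q) +++ reversepath a)"
proof -
  let ?b = "reversepath a" and ?H = "homotopic_paths S"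
  note [simp] = path_image_join
  have P [simp]: "path p" "path_image p \<subseteq> S" "pathstart p = x" "pathfinish p = x"
    and Q [simp]: "path q" "path_image q \<subseteq> S" "pathstart q = x" "pathfinish q = x"
    using p q by (auto simp: based_loops_def)
  note [simp] = a
  have lid: "?H (linepath x x +++ (q +++ ?b)) (q +++ ?b)"
    using homotopic_paths_lid[of "q +++ ?b" S] by simp
  have "?H ((a +++ p +++ ?b) +++ (a +++ q +++ ?b)) (a +++ (p +++ ?b) +++ (a +++ q +++ ?b))"
    by (rule homotopic_paths_sym, rule homotopic_paths_assoc) auto
  also have "?H \<dots> (a +++ p +++ ?b +++ (a +++ q +++ ?b))"
    by (rule homotopic_paths_join, simp, rule homotopic_paths_sym, rule homotopic_paths_assoc) auto
  also have "?H \<dots> (a +++ p +++ (?b +++ a) +++ (q +++ ?b))"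
    by (rule homotopic_paths_join, simp, rule homotopic_paths_join, simp, rule homotopic_paths_assoc) auto
  also have "?H \<dots> (a +++ p +++ linepath x x +++ (q +++ ?b))"
    using homotopic_paths_linv[of a S]
    by (intro homotopic_paths_join) auto
  also have "?H \<dots> (a +++ p +++ (q +++ ?b))"
    by (rule homotopic_paths_join, simp, rule homotopic_paths_join, simp, rule lid) auto
  also have "?H \<dots> (a +++ (p +++ q) +++ ?b)"
    by (rule homotopic_paths_join, simp, rule homotopic_paths_assoc) auto
  finally show ?thesis
    using conj_based_loop[OF p a] conj_based_loop[OF q a] by (simp add: mult_path_class path_class_eqI)
qed

lemma conj_trivial:
  fixes a :: "real \<Rightarrow> 'a::real_normed_vector"
  assumes a: "path a" "path_image a \<subseteq> S" "pathfinish a = x"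
  shows "homotopic_paths S (a +++ linepath x x +++ reversepath a) (linepath (pathstart a) (pathstart a))"
proof -
  have "homotopic_paths S (linepath x x +++ reversepath a) (reversepath a)"
    using a homotopic_paths_lid[of "reversepath a" S] by simp
  then have "homotopic_paths S (a +++ linepath x x +++ reversepath a) (a +++ reversepath a)"
    by (rule homotopic_paths_join[rotated]) (use a in auto)
  also have "homotopic_paths S \<dots> (linepath (pathstart a) (pathstart a))"
    using a by (intro homotopic_paths_rinv)
  finally show ?thesis .
qed

lemma theta_near_b0:
  assumes "dist z b0 < 1 / real (Suc k)" "j \<le> k"
  shows "theta j z \<noteq> -1"
proof
  assume "theta j z = -1"
  then have j: "real j * fst z = 2"
    by (auto simp: theta_def complex_eq_iff split: if_splits)
  have "\<bar>fst z\<bar> < 1 / real (Suc k)"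
    using assms(1) dist_fst_le[of z b0] by (simp add: b0_def dist_real_def)
  then have "real (Suc k) * \<bar>fst z\<bar> < 1"
    by (simp add: field_simps)
  moreover have "real j * \<bar>fst z\<bar> \<le> real (Suc k) * \<bar>fst z\<bar>"
    using assms(2) by (intro mult_right_mono) auto
  moreover have "real j * fst z \<le> real j * \<bar>fst z\<bar>"
    by (intro mult_left_mono) auto
  ultimately show False
    using j by linarith
qed

text \<open>Since \<open>c_inf\<close> is the product of finitely many \<open>c_fin i\<close> and the class of a tail, it is enough to find
  one tail whose image is in the subgroup.\<close>

lemma closed_scattered_classes:
  "closed_subgroup earring_plus b0_plus C_fin c_inf earring_plus b0_plus scattered_classes"
  unfolding closed_subgroup_def
proof (intro conjI allI impI subgroup_scattered_classes)
  fix f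
  assume "continuous_on earring_plus f \<and> f \<in> earring_plus \<rightarrow> earring_plus \<and> f b0_plus = b0_plus \<and>
      induced_hom earring_plus f ` C_fin \<subseteq> scattered_classes"
  then have f: "continuous_on earring_plus f" "f \<in> earring_plus \<rightarrow> earring_plus" "f b0_plus = b0_plus"
    and fC: "\<And>A. A \<in> C_fin \<Longrightarrow> induced_hom earring_plus f A \<in> scattered_classes"
    by blast+
  define a where "a = f \<circ> whisker"
  define x where "x = f b0"
  define p where "p n = f \<circ> ell (Suc n)" for n
  define t where "t n = f \<circ> ell_tail n" for n
  let ?conj = "\<lambda>q. a +++ q +++ reversepath a"
  have fpath: "path (f \<circ> q)" "path_image (f \<circ> q) \<subseteq> earring_plus"
    if "path q" "path_image q \<subseteq> earring_plus" for q
    using that f(2) continuous_on_subset[OF f(1)]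
    by (auto simp: path_image_compose intro!: path_continuous_image)
  have floop: "f \<circ> q \<in> based_loops earring_plus x" if "q \<in> based_loops earring_plus b0" for q
    using that fpath[of q] by (auto simp: based_loops_def x_def pathstart_compose pathfinish_compose)
  have a: "path a" "path_image a \<subseteq> earring_plus" "pathfinish a = x" "pathstart a = b0_plus"
    unfolding a_def using fpath[of whisker] path_whisker f(3)
    by (auto simp: x_def pathstart_compose pathfinish_compose)
  have pl: "p n \<in> based_loops earring_plus x" and tl: "t n \<in> based_loops earring_plus x" for n
    unfolding p_def t_def by (intro floop ell_based_loop ell_tail_based_loop; simp)+
  have hom: "induced_hom earring_plus f (whisker_class q) = path_class earring_plus (?conj (f \<circ> q))"
    if q: "q \<in> based_loops earring_plus b0" for q
  proof -
    have "whisker +++ q +++ reversepath whisker \<in> based_loops earring_plus b0_plus"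
      using conj_based_loop[OF q path_whisker(1,4,3)] path_whisker(2) by simp
    then show ?thesis
      unfolding whisker_class_def a_def
      by (subst induced_hom_path_class[OF f(1,2)])
        (auto simp: path_compose_join path_compose_reversepath)
  qed
  have cl: "?conj q \<in> based_loops earring_plus b0_plus" if "q \<in> based_loops earring_plus x" for q
    using conj_based_loop[OF that a(1-3)] a(4) by simp
  have pK: "path_class earring_plus (?conj (p n)) \<in> scattered_classes" for n
    using fC[OF c_fin_in_C_fin[of "Suc n"]] hom[OF ell_based_loop[of "Suc n"]]
    by (simp add: c_fin_def p_def)
  have split: "homotopic_paths earring_plus (t n) (p n +++ t (Suc n))" for n
    unfolding t_def p_def path_compose_join[symmetric]
    by (rule homotopic_paths_continuous_image[OF ell_tail_split f(1,2)])
  have mult: "path_class earring_plus (?conj (t n)) =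
      path_class earring_plus (?conj (p n)) \<otimes>\<^bsub>fundamental_group earring_plus b0_plus\<^esub>
      path_class earring_plus (?conj (t (Suc n)))" for n
    using conj_mult[OF pl tl a(1-3)] path_class_eqI[OF conj_homotopic[OF split tl a(1-3)]]
    by (simp add: a(4))
  have near: "\<exists>N. \<forall>n\<ge>N. \<forall>s\<in>{0..1}. dist (p n s) x < e \<and> dist (t n s) x < e" if e: "e > 0" for e
  proof -
    obtain d where d: "d > 0" "\<And>z. z \<in> earring_plus \<Longrightarrow> dist z b0 < d \<Longrightarrow> dist (f z) x < e"
      using f(1) b0_in e unfolding continuous_on_iff x_def by blast
    obtain N :: nat where N: "3 / d < real N"
      using reals_Archimedean2 by blast
    have "3 / d > 0"
      using d(1) by simp
    then have N1: "real N > 0"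
      using N by linarith
    have small: "3 / real n < d" if "n \<ge> N" for n
    proof -
      have "3 / d < real n" "real n > 0"
        using N N1 that by linarith+
      then show ?thesis
        using d(1) by (simp add: field_simps)
    qed
    have "dist (p n s) x < e \<and> dist (t n s) x < e" if n: "n \<ge> N" and s: "s \<in> {0..1}" for n s
    proof
      have "dist (ell (Suc n) s) b0 < d"
        using ell_small[of "Suc n" s] small[of "Suc n"] n by linarith
      then show "dist (p n s) x < e"
        using d(2)[of "ell (Suc n) s"] ell_in_earring_plus[of "Suc n" s] by (simp add: p_def)
      have "dist (ell_tail n s) b0 < d"
        using ell_tail_small[of n s] small[OF n] n N1 s by force
      moreover have "ell_tail n s \<in> earring_plus"
        using ell_inf_in_earring_plus by (simp add: ell_tail_def subpath_def)
      ultimately show "dist (t n s) x < e"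
        using d(2) by (simp add: t_def)
    qed
    then show ?thesis
      by blast
  qed
  have "\<exists>n. path_class earring_plus (?conj (t n)) \<in> scattered_classes"
  proof (cases "x = b0")
    case True
    have anch: "anchored q" if "q \<in> based_loops earring_plus x" for q
      using that by (auto simp: anchored_def based_loops_def True)
    have small: "\<exists>N. \<forall>n\<ge>N. \<forall>j\<le>k. \<forall>s\<in>{0..1}. theta j (p n s) \<noteq> -1 \<and> theta j (t n s) \<noteq> -1" for k
      using near[of "1 / real (Suc k)"] theta_near_b0[of _ k] True by (metis zero_less_divide_1_iff of_nat_0_less_iff zero_less_Suc)
    obtain n where "countable (visited (?conj (t n)))"
    proof (rule countable_visited_conjugate_infinite_product[of a p t])
      show "anchored a"
        using a by (auto simp: anchored_def True theta_b0_plus)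
      show "countable (visited (?conj (p n)))" for n
        using pK path_class_scattered_iff[OF cl[OF pl]] by simp
      show "\<exists>N. \<forall>n\<ge>N. \<forall>j\<le>k. \<forall>s\<in>{0..1}. theta j (p n s) \<noteq> -1"
        "\<exists>N. \<forall>n\<ge>N. \<forall>j\<le>k. \<forall>s\<in>{0..1}. theta j (t n s) \<noteq> -1" for k
        using small[of k] by blast+
    qed (use a(3) pl tl anch split in \<open>auto simp: based_loops_def\<close>)
    then show ?thesis
      using path_class_scattered_iff[OF cl[OF tl]] by blast
  next
    case False
    have "x \<in> earring_plus"
      using f(2) b0_in by (auto simp: x_def)
    then obtain r where r: "r > 0" "\<And>q. \<lbrakk>path q; path_image q \<subseteq> earring_plus \<inter> ball x r;
        pathstart q = x; pathfinish q = x\<rbrakk> \<Longrightarrow> homotopic_paths earring_plus q (linepath x x)"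
      using small_loop_nullhomotopic False by metis
    obtain n where n: "\<And>s. s \<in> {0..1} \<Longrightarrow> dist (t n s) x < r"
      using near[OF r(1)] by blast
    have "homotopic_paths earring_plus (t n) (linepath x x)"
      using tl[of n] n by (intro r(2)) (auto simp: based_loops_def path_image_def dist_commute)
    then have "homotopic_paths earring_plus (?conj (t n)) (?conj (linepath x x))"
      by (rule conj_homotopic[OF _ tl a(1-3)])
    then have "homotopic_paths earring_plus (?conj (t n)) (linepath b0_plus b0_plus)"
      using conj_trivial[OF a(1-3)] a(4) homotopic_paths_trans by metis
    then have "visited (?conj (t n)) = visited (linepath b0_plus b0_plus)"
      by (rule visited_homotopic[OF _ based_loops_anchored[OF cl[OF tl]]])
    also have "\<dots> = {}"
      by (rule frequent_trivial) (simp add: crossings_trivial linepath_refl theta_b0_plus)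
    finally show ?thesis
      using path_class_scattered_iff[OF cl[OF tl]] by (metis countable_empty)
  qed
  then obtain n where n: "path_class earring_plus (?conj (t n)) \<in> scattered_classes"
    by blast
  have "path_class earring_plus (?conj (t 0)) \<in> scattered_classes"
    using n
  proof (induction n)
    case (Suc n)
    then show ?case
      using subgroup.m_closed[OF subgroup_scattered_classes pK[of n] Suc.prems] mult[of n] by simp
  qed
  then show "induced_hom earring_plus f c_inf \<in> scattered_classes"
    using hom[OF ell_tail_based_loop[of 0]] by (simp add: c_inf_def ell_tail_0 t_def)
qed


section \<open>The gaps of the Cantor set\<close>

text \<open>Left endpoint of the \<open>k\<close>-th interval, counted from \<open>0\<close>, at stage \<open>n\<close> of the construction of the
  Cantor set. The recursion descends from an interval to its two thirds, that is, it reads the binary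
  digits of \<open>k\<close> from the last one, which makes the tree of intervals visible.\<close>

fun cantor_left :: "nat \<Rightarrow> nat \<Rightarrow> real" where
  "cantor_left 0 k = 0"
| "cantor_left (Suc n) k = cantor_left n (k div 2) + (if odd k then 2 / 3 ^ Suc n else 0)"

text \<open>The gap removed from the \<open>k\<close>-th interval of stage \<open>n\<close>. It has length \<open>1 / 3 ^ (n + 1)\<close> and is thus the
  \<open>(k + 1)\<close>-st gap of stage \<open>n + 1\<close> in the numbering of \<open>cantor_gap\<close>, which starts at \<open>1\<close>.\<close>

definition gap_lo :: "nat \<Rightarrow> nat \<Rightarrow> real" where
  "gap_lo n k = cantor_left n k + 1 / 3 ^ Suc n"

definition gap_hi :: "nat \<Rightarrow> nat \<Rightarrow> real" where
  "gap_hi n k = cantor_left n k + 2 / 3 ^ Suc n"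

lemma gap_lo_less_hi: "gap_lo n k < gap_hi n k"
  by (simp add: gap_lo_def gap_hi_def divide_strict_right_mono)

lemma gap_inside: "cantor_left n k < gap_lo n k" "gap_hi n k < cantor_left n k + 1 / 3 ^ n"
  by (simp_all add: gap_lo_def gap_hi_def field_simps)

lemma cantor_left_sorted:
  "\<lbrakk>k < k'; k' < 2 ^ n\<rbrakk> \<Longrightarrow> cantor_left n k + 2 / 3 ^ n \<le> cantor_left n k'"
proof (induction n arbitrary: k k')
  case (Suc n)
  show ?case
  proof (cases "k div 2 = k' div 2")
    case True
    then have "even k" "odd k'"
      using Suc.prems(1) by presburger+
    then show ?thesis
      using True by simp
  next
    case False
    then have lt: "k div 2 < k' div 2"
      using Suc.prems(1) by (simp add: div_le_mono le_neq_implies_less)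
    have IH: "cantor_left n (k div 2) + 2 / 3 ^ n \<le> cantor_left n (k' div 2)"
      using Suc.IH[OF lt] Suc.prems(2) by simp
    have k: "cantor_left (Suc n) k \<le> cantor_left n (k div 2) + 2 / 3 ^ Suc n"
      and k': "cantor_left n (k' div 2) \<le> cantor_left (Suc n) k'"
      by simp_all
    have "(0::real) \<le> 2 / 3 ^ Suc n" "(2::real) / 3 ^ n = 3 * (2 / 3 ^ Suc n)"
      by (simp_all add: field_simps)
    then show ?thesis
      using IH k k' by linarith
  qed
qed simp

text \<open>Changing the leading binary digit of \<open>k\<close> instead of the last one corresponds to the two similarities
  in the definition of \<open>cantor_approx\<close>.\<close>

lemma cantor_left_prefix:
  "k < 2 ^ n \<Longrightarrow> cantor_left (Suc n) k = cantor_left n k / 3"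
  "k < 2 ^ n \<Longrightarrow> cantor_left (Suc n) (2 ^ n + k) = (cantor_left n k + 2) / 3"
proof (induction n arbitrary: k)
  case (Suc n)
  { case 1
    then have "k div 2 < 2 ^ n"
      by simp
    then have "cantor_left (Suc n) (k div 2) = cantor_left n (k div 2) / 3"
      by (rule Suc.IH)
    then show ?case
      unfolding cantor_left.simps(2)[of "Suc n" k] cantor_left.simps(2)[of n k]
      by (simp del: cantor_left.simps add: add_divide_distrib)
  next
    case 2
    then have "k div 2 < 2 ^ n"
      by simp
    then have "cantor_left (Suc n) (2 ^ n + k div 2) = (cantor_left n (k div 2) + 2) / 3"
      by (rule Suc.IH)
    moreover have "(2 ^ Suc n + k) div 2 = 2 ^ n + k div 2" "odd (2 ^ Suc n + k) = odd k"
      by auto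
    ultimately show ?case
      unfolding cantor_left.simps(2)[of "Suc n" "2 ^ Suc n + k"] cantor_left.simps(2)[of n k]
      by (simp del: cantor_left.simps add: add_divide_distrib)
  }
qed auto

definition cantor_interval :: "nat \<Rightarrow> nat \<Rightarrow> real set" where
  "cantor_interval n k = {cantor_left n k..cantor_left n k + 1 / 3 ^ n}"

lemma cantor_approx_eq: "cantor_approx n = (\<Union>k<2 ^ n. cantor_interval n k)"
proof (induction n)
  case (Suc n)
  have img: "(\<lambda>x. (x + c) / 3) ` {l..l + 1 / 3 ^ n} = {(l + c) / 3..(l + c) / 3 + 1 / 3 ^ Suc n}"
    for l c :: real
  proof -
    have "(\<lambda>x. (x + c) / 3) = (\<lambda>x. x / 3 + c / 3)"
      by (auto simp: add_divide_distrib)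
    then show ?thesis
      using image_affinity_atLeastAtMost_div[of 3 "c / 3" l "l + 1 / 3 ^ n"]
      by (simp add: add_divide_distrib)
  qed
  have 1: "(\<lambda>x. x / 3) ` cantor_interval n k = cantor_interval (Suc n) k" if "k < 2 ^ n" for k
    using img[of 0 "cantor_left n k"] unfolding cantor_interval_def cantor_left_prefix(1)[OF that] by simp
  have 2: "(\<lambda>x. (x + 2) / 3) ` cantor_interval n k = cantor_interval (Suc n) (2 ^ n + k)"
    if "k < 2 ^ n" for k
    using img[of 2 "cantor_left n k"] unfolding cantor_interval_def cantor_left_prefix(2)[OF that] by simp
  have split: "{..<2 ^ Suc n} = {..<2 ^ n} \<union> (\<lambda>k. 2 ^ n + k) ` {..<2 ^ n :: nat}"
  proof -
    have "k \<in> (\<lambda>k. 2 ^ n + k) ` {..<2 ^ n}" if "\<not> k < 2 ^ n" "k < 2 ^ Suc n" for k :: nat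
      using that by (intro image_eqI[of _ _ "k - 2 ^ n"]) auto
    then show ?thesis
      by fastforce
  qed
  have "cantor_approx (Suc n) = (\<Union>k<2 ^ n. (\<lambda>x. x / 3) ` cantor_interval n k) \<union>
      (\<Union>k<2 ^ n. (\<lambda>x. (x + 2) / 3) ` cantor_interval n k)"
    by (simp only: cantor_approx.simps Suc image_UN)
  also have "\<dots> = (\<Union>k<2 ^ n. cantor_interval (Suc n) k) \<union>
      (\<Union>k<2 ^ n. cantor_interval (Suc n) (2 ^ n + k))"
    by (intro arg_cong2[where f = "(\<union>)"] SUP_cong refl 1 2) auto
  also have "\<dots> = (\<Union>k<2 ^ Suc n. cantor_interval (Suc n) k)"
    unfolding split UN_Un by blast
  finally show ?case .
qed (simp add: cantor_interval_def lessThan_Suc)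

lemma cantor_interval_children:
  "cantor_interval n k = cantor_interval (Suc n) (2 * k) \<union> {gap_lo n k<..<gap_hi n k} \<union>
     cantor_interval (Suc n) (Suc (2 * k))"
proof -
  have "(0::real) < 1 / 3 ^ Suc n"
    by simp
  moreover have "(1::real) / 3 ^ n = 3 * (1 / 3 ^ Suc n)" "(2::real) / 3 ^ Suc n = 2 * (1 / 3 ^ Suc n)"
    by (simp_all add: field_simps)
  moreover define d where "d = (1::real) / 3 ^ Suc n"
  ultimately have "0 < d" "1 / 3 ^ n = 3 * d" "2 / 3 ^ Suc n = 2 * d" "1 / 3 ^ Suc n = d"
    by metis+
  then show ?thesis
    unfolding cantor_interval_def gap_lo_def gap_hi_def cantor_left.simps by auto
qed

lemma cantor_interval_parent: "cantor_interval (Suc n) k \<subseteq> cantor_interval n (k div 2)"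
proof -
  let ?h = "k div 2"
  have "k = 2 * ?h \<or> k = Suc (2 * ?h)"
    by presburger
  then have "cantor_interval (Suc n) k \<in>
      {cantor_interval (Suc n) (2 * ?h), cantor_interval (Suc n) (Suc (2 * ?h))}"
    by (metis insertCI)
  then show ?thesis
    unfolding cantor_interval_children[of n ?h] by blast
qed

lemma gap_in_interval: "{gap_lo n k..gap_hi n k} \<subseteq> cantor_interval n k"
  using gap_inside[of n k] by (auto simp: cantor_interval_def)

text \<open>The \<open>k'\<close>-th interval of stage \<open>n'\<close> lies inside an interval of stage \<open>n\<close>. If that is another one than the \<open>k\<close>-th, the two
  are disjoint; if it is the \<open>k\<close>-th, the smaller interval is inside its left or right third.\<close>

lemma gap_separated:
  assumes "n < n' \<or> (n = n' \<and> k \<noteq> k')" "k < 2 ^ n" "k' < 2 ^ n'"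
  shows "gap_hi n k \<le> cantor_left n' k' \<or> cantor_left n' k' + 1 / 3 ^ n' \<le> gap_lo n k"
proof -
  have sib: "gap_hi n k \<le> cantor_left n k' \<or> cantor_left n k' + 1 / 3 ^ n \<le> gap_lo n k"
    if "k \<noteq> k'" "k < 2 ^ n" "k' < 2 ^ n" for n k k'
  proof (cases "k < k'")
    case True
    have "(1::real) / 3 ^ n \<le> 2 / 3 ^ n"
      by (simp add: divide_right_mono)
    then show ?thesis
      using gap_inside(2)[of n k] cantor_left_sorted[OF True that(3)] by linarith
  next
    case False
    then have "k' < k"
      using that(1) by simp
    have "(1::real) / 3 ^ n \<le> 2 / 3 ^ n"
      by (simp add: divide_right_mono)
    then show ?thesis
      using gap_inside(1)[of n k] cantor_left_sorted[OF \<open>k' < k\<close> that(2)] by linarith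
  qed
  have "n \<le> n'"
    using assms(1) by auto
  then show ?thesis
    using assms(1,3)
  proof (induction n' arbitrary: k' rule: dec_induct)
    case base
    then show ?case
      using sib assms(2) by blast
  next
    case (step n')
    have kb: "k' div 2 < 2 ^ n'"
      using step.prems(2) by auto
    have sub: "cantor_left n' (k' div 2) \<le> cantor_left (Suc n') k'"
      "cantor_left (Suc n') k' + 1 / 3 ^ Suc n' \<le> cantor_left n' (k' div 2) + 1 / 3 ^ n'"
      using cantor_interval_parent[of n' k'] unfolding cantor_interval_def by (simp_all add: atLeastatMost_subset_iff)
    show ?case
    proof (cases "n < n' \<or> k \<noteq> k' div 2")
      case True
      then have "n < n' \<or> (n = n' \<and> k \<noteq> k' div 2)"
        using step.hyps by auto
      from step.IH[OF this kb] show ?thesis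
        using sub by linarith
    next
      case False
      then have "n = n'" "k = k' div 2"
        using step.hyps by auto
      then show ?thesis
        by (auto simp: gap_lo_def gap_hi_def)
    qed
  qed
qed

lemma gap_closed_disjoint:
  assumes "(n, k) \<noteq> (n', k')" "k < 2 ^ n" "k' < 2 ^ n'"
  shows "gap_hi n k < gap_lo n' k' \<or> gap_hi n' k' < gap_lo n k"
proof -
  have main: "gap_hi n k < gap_lo n' k' \<or> gap_hi n' k' < gap_lo n k"
    if "n < n' \<or> (n = n' \<and> k \<noteq> k')" "k < 2 ^ n" "k' < 2 ^ n'" for n k n' k'
    using gap_separated[OF that] gap_inside[of n' k'] by linarith
  show ?thesis
    using main[of n n' k k'] main[of n' n k' k] assms by (metis linorder_neqE_nat)
qed

lemma gap_disjoint_cantor_approx: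
  assumes "k < 2 ^ n"
  shows "{gap_lo n k<..<gap_hi n k} \<inter> cantor_approx (Suc n) = {}"
proof -
  have "{gap_lo n k<..<gap_hi n k} \<inter> cantor_interval (Suc n) k' = {}" if "k' < 2 ^ Suc n" for k'
    using gap_separated[of n "Suc n" k k'] assms that by (auto simp: cantor_interval_def)
  then show ?thesis
    unfolding cantor_approx_eq by blast
qed

lemma cantor_approx_antimono: "m \<le> n \<Longrightarrow> cantor_approx n \<subseteq> cantor_approx m"
proof (induction n rule: dec_induct)
  case (step n)
  have "cantor_interval (Suc n) k \<subseteq> cantor_approx n" if "k < 2 ^ Suc n" for k
  proof -
    have "k div 2 < 2 ^ n"
      using that by auto
    then show ?thesis
      using cantor_interval_parent[of n k] unfolding cantor_approx_eq[of n] by blast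
  qed
  then show ?case
    using step.IH unfolding cantor_approx_eq[of "Suc n"] by blast
qed simp

lemma cantor_interval_ends:
  assumes "k < 2 ^ n"
  shows "cantor_left n k \<in> cantor" "cantor_left n k + 1 / 3 ^ n \<in> cantor"
proof -
  have "\<exists>k<2 ^ (n + d). cantor_left (n + d) k = cantor_left n k'" if "k' < 2 ^ n" for d k'
  proof (induction d)
    case (Suc d)
    then obtain k where "k < 2 ^ (n + d)" "cantor_left (n + d) k = cantor_left n k'"
      by blast
    then show ?case
      by (intro exI[of _ "2 * k"]) auto
  qed (use that in auto)
  then have l: "cantor_left n k \<in> cantor_approx (n + d)" for d
    using assms unfolding cantor_approx_eq cantor_interval_def by fastforce
  have "\<exists>k<2 ^ (n + d). cantor_left (n + d) k + 1 / 3 ^ (n + d) = cantor_left n k' + 1 / 3 ^ n"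
    if "k' < 2 ^ n" for d k'
  proof (induction d)
    case (Suc d)
    then obtain k where k: "k < 2 ^ (n + d)"
      "cantor_left (n + d) k + 1 / 3 ^ (n + d) = cantor_left n k' + 1 / 3 ^ n"
      by blast
    have "cantor_left (n + Suc d) (Suc (2 * k)) + 1 / 3 ^ (n + Suc d) =
        cantor_left (n + d) k + 1 / 3 ^ (n + d)"
      by (simp add: field_simps)
    then show ?case
      using k by (intro exI[of _ "Suc (2 * k)"]) auto
  qed (use that in auto)
  note right = this
  have r: "cantor_left n k + 1 / 3 ^ n \<in> cantor_approx (n + d)" for d
  proof -
    obtain i where i: "i < 2 ^ (n + d)"
      "cantor_left (n + d) i + 1 / 3 ^ (n + d) = cantor_left n k + 1 / 3 ^ n"
      using right[OF assms] by blast
    then have "cantor_left n k + 1 / 3 ^ n \<in> cantor_interval (n + d) i"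
      unfolding cantor_interval_def i(2)[symmetric] by simp
    then show ?thesis
      unfolding cantor_approx_eq using i(1) by blast
  qed
  have "z \<in> cantor" if "\<And>d. z \<in> cantor_approx (n + d)" for z
    unfolding cantor_def
  proof
    fix N
    show "z \<in> cantor_approx N"
      using that[of N] cantor_approx_antimono[of N "n + N"] by auto
  qed
  then show "cantor_left n k \<in> cantor" "cantor_left n k + 1 / 3 ^ n \<in> cantor"
    using l r by auto
qed

lemma gap_ends_in_cantor:
  assumes "k < 2 ^ n"
  shows "gap_lo n k \<in> cantor" "gap_hi n k \<in> cantor"
proof -
  have "gap_lo n k = cantor_left (Suc n) (2 * k) + 1 / 3 ^ Suc n"
    "gap_hi n k = cantor_left (Suc n) (Suc (2 * k))"
    by (simp_all add: gap_lo_def gap_hi_def)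
  then show "gap_lo n k \<in> cantor" "gap_hi n k \<in> cantor"
    using cantor_interval_ends[of "2 * k" "Suc n"] cantor_interval_ends[of "Suc (2 * k)" "Suc n"] assms
    by auto
qed

lemma gap_in_complement:
  assumes "k < 2 ^ n"
  shows "{gap_lo n k<..<gap_hi n k} \<subseteq> {0..1} - cantor"
proof -
  have "cantor_interval n k \<subseteq> cantor_approx n"
    using assms unfolding cantor_approx_eq by blast
  then have "cantor_interval n k \<subseteq> {0..1}"
    using cantor_approx_antimono[of 0 n] by simp
  moreover have "{gap_lo n k<..<gap_hi n k} \<subseteq> cantor_interval n k"
    using gap_in_interval[of n k] greaterThanLessThan_subseteq_atLeastAtMost_iff by auto
  moreover have "cantor \<subseteq> cantor_approx (Suc n)"
    unfolding cantor_def by blast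
  ultimately show ?thesis
    using gap_disjoint_cantor_approx[OF assms] by blast
qed

text \<open>The endpoints of a gap belong to the Cantor set, so a connected subset of the complement cannot reach
  beyond them.\<close>

lemma gap_component:
  assumes "k < 2 ^ n"
  shows "{gap_lo n k<..<gap_hi n k} \<in> components ({0..1} - cantor)"
  unfolding in_components_maximal
proof (intro conjI allI impI gap_in_complement[OF assms])
  show "{gap_lo n k<..<gap_hi n k} \<noteq> {}"
    using gap_lo_less_hi[of n k] by simp
  fix D assume D: "D \<noteq> {} \<and> {gap_lo n k<..<gap_hi n k} \<subseteq> D \<and> D \<subseteq> {0..1} - cantor \<and> connected D"
  then have conn: "connected D"
    by simp
  obtain c where c: "gap_lo n k < c" "c < gap_hi n k"
    using gap_lo_less_hi dense by blast
  then have mid: "c \<in> D"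
    using D by auto
  have "D \<subseteq> {gap_lo n k<..<gap_hi n k}"
  proof
    fix z assume z: "z \<in> D"
    have "gap_lo n k \<notin> D" "gap_hi n k \<notin> D"
      using gap_ends_in_cantor[OF assms] D by auto
    moreover have "gap_lo n k \<in> D" if "z \<le> gap_lo n k"
      by (rule connectedD_interval[OF conn z mid that]) (use c in simp)
    moreover have "gap_hi n k \<in> D" if "gap_hi n k \<le> z"
      by (rule connectedD_interval[OF conn mid z _ that]) (use c in simp)
    ultimately show "z \<in> {gap_lo n k<..<gap_hi n k}"
      by force
  qed
  then show "D = {gap_lo n k<..<gap_hi n k}"
    using D by blast
qed auto

text \<open>A point of the complement is removed at some stage, when it lies in the middle third of an interval.\<close>

lemma component_is_gap:
  assumes "I \<in> components ({0..1} - cantor)"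
  obtains n k where "k < 2 ^ n" "I = {gap_lo n k<..<gap_hi n k}"
proof -
  obtain z where z: "z \<in> I"
    using assms in_components_nonempty by fastforce
  then have "z \<in> {0..1} - cantor"
    using assms in_components_subset by blast
  then obtain N where N: "z \<notin> cantor_approx N" "z \<in> cantor_approx 0"
    by (auto simp: cantor_def)
  obtain n where n: "z \<in> cantor_approx n" "z \<notin> cantor_approx (Suc n)"
  proof (rule ccontr)
    assume "\<not> thesis"
    then have step: "z \<in> cantor_approx n \<Longrightarrow> z \<in> cantor_approx (Suc n)" for n
      using that by blast
    have "z \<in> cantor_approx n" for n
      by (induction n) (use N(2) step in blast)+
    then show False
      using N(1) by blast
  qed
  then obtain k where k: "k < 2 ^ n" "z \<in> cantor_interval n k"
    unfolding cantor_approx_eq by auto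
  have "z \<notin> cantor_interval (Suc n) (2 * k)" "z \<notin> cantor_interval (Suc n) (Suc (2 * k))"
    using n(2) k(1) unfolding cantor_approx_eq by auto
  then have "z \<in> {gap_lo n k<..<gap_hi n k}"
    using k(2) cantor_interval_children[of n k] by blast
  then have "I = {gap_lo n k<..<gap_hi n k}"
    using components_nonoverlap[OF assms gap_component[OF k(1)]] z by blast
  then show ?thesis
    using that k(1) by blast
qed

lemma cantor_gaps_eq: "cantor_gaps (Suc n) = (\<lambda>k. {gap_lo n k<..<gap_hi n k}) ` {..<2 ^ n}"
proof -
  have len: "Sup {gap_lo m k<..<gap_hi m k} - Inf {gap_lo m k<..<gap_hi m k} = 1 / 3 ^ Suc m" for m k
    using gap_lo_less_hi[of m k] by (simp add: gap_lo_def gap_hi_def diff_divide_distrib[symmetric])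
  have "m = n" if "(1::real) / 3 ^ Suc m = 1 / 3 ^ Suc n" for m
  proof -
    have "(3::real) ^ Suc m = 3 ^ Suc n"
      using that by simp
    then show ?thesis
      by (simp only: power_inject_exp)
  qed
  then show ?thesis
    unfolding cantor_gaps_def using gap_component len
    by (auto elim!: component_is_gap simp del: power_Suc)
qed

lemma gap_lo_less_iff:
  assumes "k < 2 ^ n" "k' < 2 ^ n"
  shows "gap_lo n k \<le> gap_lo n k' \<longleftrightarrow> k \<le> k'"
proof -
  have "gap_lo n k < gap_lo n k'" if "k < k'" "k' < 2 ^ n" for k k'
  proof -
    have "(0::real) < 2 / 3 ^ n"
      by simp
    then have "cantor_left n k < cantor_left n k'"
      using cantor_left_sorted[OF that] by linarith
    then show ?thesis
      by (simp add: gap_lo_def)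
  qed
  then show ?thesis
    using assms by (metis linorder_not_le order_le_less)
qed

lemma cantor_gap_eq:
  assumes "k < 2 ^ n"
  shows "cantor_gap (Suc n) (Suc k) = {gap_lo n k<..<gap_hi n k}"
proof -
  let ?I = "\<lambda>k. {gap_lo n k<..<gap_hi n k}"
  have inf: "Inf (?I i) = gap_lo n i" for i
    using gap_lo_less_hi[of n i] by simp
  have inj: "inj_on ?I {..<2 ^ n}"
  proof (rule inj_onI)
    fix i j assume "i \<in> {..<2 ^ n}" "j \<in> {..<2 ^ n}" "?I i = ?I j"
    then show "i = j"
      using inf[of i] inf[of j] gap_lo_less_iff[of i n j] gap_lo_less_iff[of j n i] by simp
  qed
  have card: "card {J \<in> cantor_gaps (Suc n). Inf J \<le> Inf (?I i)} = Suc i" if "i < 2 ^ n" for i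
  proof -
    have "{J \<in> cantor_gaps (Suc n). Inf J \<le> Inf (?I i)} = ?I ` {..i}"
      unfolding cantor_gaps_eq using that by (auto simp: inf gap_lo_less_iff)
    moreover have "card (?I ` {..i}) = card {..i}"
      by (rule card_image) (rule inj_on_subset[OF inj], use that in auto)
    ultimately show ?thesis
      by simp
  qed
  show ?thesis
    unfolding cantor_gap_def
  proof (rule the_equality)
    show "?I k \<in> cantor_gaps (Suc n) \<and> card {J \<in> cantor_gaps (Suc n). Inf J \<le> Inf (?I k)} = Suc k"
      using card assms by (auto simp: cantor_gaps_eq)
    fix I assume I: "I \<in> cantor_gaps (Suc n) \<and> card {J \<in> cantor_gaps (Suc n). Inf J \<le> Inf I} = Suc k"
    then obtain i where "i < 2 ^ n" "I = ?I i"
      unfolding cantor_gaps_eq by auto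
    then show "I = ?I k"
      using card[of i] I by auto
  qed
qed


section \<open>The loop over the gaps visits uncountably many points\<close>

text \<open>The fraction of the gap that has been traversed at time \<open>t\<close>. It turns out to be the lift of
  \<open>ell_tau\<close> with respect to the circle attached to this gap.\<close>

definition gap_progress :: "nat \<Rightarrow> nat \<Rightarrow> real \<Rightarrow> real" where
  "gap_progress n k t = max 0 (min 1 ((t - gap_lo n k) / (gap_hi n k - gap_lo n k)))"

lemma gap_progress_before: "t \<le> gap_lo n k \<Longrightarrow> gap_progress n k t = 0"
  using gap_lo_less_hi[of n k] by (simp add: gap_progress_def divide_le_0_iff min_le_iff_disj)

lemma gap_progress_after: "gap_hi n k \<le> t \<Longrightarrow> gap_progress n k t = 1"
  using gap_lo_less_hi[of n k] by (simp add: gap_progress_def le_divide_eq min_def)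

lemma gap_progress_during:
  assumes "t \<in> {gap_lo n k..gap_hi n k}"
  shows "gap_progress n k t = (t - gap_lo n k) / (gap_hi n k - gap_lo n k)"
  using gap_lo_less_hi[of n k] assms by (simp add: gap_progress_def divide_le_eq)

lemma cis_gap_progress_outside:
  "t \<notin> {gap_lo n k..gap_hi n k} \<Longrightarrow> cis (2 * pi * gap_progress n k t) = 1"
  using gap_progress_before[of t n k] gap_progress_after[of n k t] by (auto simp: cis_2pi_eq_1_iff)

lemma gap_bounds:
  assumes "k < 2 ^ n"
  shows "0 < gap_lo n k" "gap_hi n k < 1"
proof -
  have "cantor \<subseteq> cantor_approx 0"
    unfolding cantor_def by blast
  then have "0 \<le> cantor_left n k" "cantor_left n k + 1 / 3 ^ n \<le> 1"
    using cantor_interval_ends[OF assms] by auto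
  then show "0 < gap_lo n k" "gap_hi n k < 1"
    using gap_inside[of n k] by linarith+
qed

lemma ell_tau_cases:
  obtains (inside) n k where "k < 2 ^ n" "t \<in> {gap_lo n k..gap_hi n k}"
      "ell_tau t = ell (2 ^ n + k) (gap_progress n k t)"
    | (outside) "\<And>n k. k < 2 ^ n \<Longrightarrow> t \<notin> {gap_lo n k..gap_hi n k}" "ell_tau t = b0"
proof -
  have ends: "Inf (cantor_gap (Suc n) (Suc k)) = gap_lo n k" "Sup (cantor_gap (Suc n) (Suc k)) = gap_hi n k"
    if "k < 2 ^ n" for n k
    using cantor_gap_eq[OF that] gap_lo_less_hi[of n k] by auto
  show ?thesis
  proof (rule insert_loops_cases[where x = b0 and J = cantor_gap_index and t = t and
        a = "\<lambda>(n, k). Inf (cantor_gap n k)" and b = "\<lambda>(n, k). Sup (cantor_gap n k)" and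
        p = "\<lambda>(n, k). ell (2 ^ (n - 1) + k - 1)", folded ell_tau_def])
    fix i assume i: "i \<in> cantor_gap_index"
      "t \<in> {(case i of (n, k) \<Rightarrow> Inf (cantor_gap n k))..(case i of (n, k) \<Rightarrow> Sup (cantor_gap n k))}"
      "ell_tau t = (case i of (n, k) \<Rightarrow> ell (2 ^ (n - 1) + k - 1))
        ((t - (case i of (n, k) \<Rightarrow> Inf (cantor_gap n k))) /
         ((case i of (n, k) \<Rightarrow> Sup (cantor_gap n k)) - (case i of (n, k) \<Rightarrow> Inf (cantor_gap n k))))"
    obtain n' k' where "i = (n', k')" "1 \<le> n'" "1 \<le> k'" "k' \<le> 2 ^ (n' - 1)"
      using i(1) by (auto simp: cantor_gap_index_def)
    then obtain n k where nk: "i = (Suc n, Suc k)" "k < 2 ^ n"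
      by (cases n'; cases k') auto
    have t: "t \<in> {gap_lo n k..gap_hi n k}"
      using i(2) by (simp add: nk ends)
    show ?thesis
      by (rule inside[OF nk(2) t]) (use i(3) in \<open>simp add: nk ends gap_progress_during[OF t]\<close>)
  next
    assume no: "\<And>i. i \<in> cantor_gap_index \<Longrightarrow>
      t \<notin> {(case i of (n, k) \<Rightarrow> Inf (cantor_gap n k))..(case i of (n, k) \<Rightarrow> Sup (cantor_gap n k))}"
      and tau: "ell_tau t = b0"
    show ?thesis
    proof (rule outside[OF _ tau])
      fix n k :: nat assume k: "k < 2 ^ n"
      have "(Suc n, Suc k) \<in> cantor_gap_index"
        using k by (simp add: cantor_gap_index_def)
      from no[OF this] show "t \<notin> {gap_lo n k..gap_hi n k}"
        by (simp add: ends[OF k])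
    qed
  qed
qed

text \<open>The circle attached to the \<open>k\<close>-th gap of stage \<open>n\<close> (both counted from \<open>0\<close>) has index \<open>2 ^ n + k\<close>, the
  number of this node in a level-by-level enumeration of the binary tree.\<close>

lemma node_unique:
  assumes "k < 2 ^ n" "k' < 2 ^ n'" "(2::nat) ^ n + k = 2 ^ n' + k'"
  shows "n = n' \<and> k = k'"
proof -
  have "\<not> n < n'" if "k < 2 ^ n" "(2::nat) ^ n + k = 2 ^ n' + k'" for n n' k k'
  proof
    assume "n < n'"
    then have "(2::nat) ^ Suc n \<le> 2 ^ n'"
      by (intro power_increasing) auto
    then show False
      using that by simp
  qed
  then have "n = n'"
    using assms by (metis linorder_neqE_nat)
  then show ?thesis
    using assms(3) by simp
qed

lemma node_ge_1: "1 \<le> 2 ^ n + (k :: nat)"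
  by (metis one_le_numeral one_le_power trans_le_add1)

lemma node_exists:
  fixes j :: nat
  assumes "j \<ge> 1"
  obtains n k where "k < 2 ^ n" "j = 2 ^ n + k"
proof -
  obtain n where "2 ^ n \<le> j" "j < 2 ^ (n + 1)"
    using ex_power_ivl1[of 2 j] assms by auto
  then show ?thesis
    by (intro that[of "j - 2 ^ n" n]) auto
qed

lemma theta_ell_tau:
  assumes k: "k < 2 ^ n"
  shows "theta (2 ^ n + k) (ell_tau t) = cis (2 * pi * gap_progress n k t)"
proof (cases rule: ell_tau_cases[of t])
  case (inside n' k')
  show ?thesis
  proof (cases "(n, k) = (n', k')")
    case True
    then show ?thesis
      using inside(3) theta_ell_same[OF node_ge_1] by simp
  next
    case False
    then have "2 ^ n + k \<noteq> 2 ^ n' + k'"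
      using node_unique[OF k inside(1)] by auto
    then have "theta (2 ^ n + k) (ell_tau t) = 1"
      unfolding inside(3) by (intro theta_ell_other node_ge_1)
    moreover have "t \<notin> {gap_lo n k..gap_hi n k}"
      using gap_closed_disjoint[OF False k inside(1)] inside(2) by auto
    ultimately show ?thesis
      by (simp add: cis_gap_progress_outside)
  qed
next
  case outside
  then show ?thesis
    using k by (simp add: cis_gap_progress_outside)
qed

lemma continuous_on_gap_progress: "continuous_on S (gap_progress n k)"
  unfolding gap_progress_def using gap_lo_less_hi[of n k]
  by (intro continuous_intros) auto

lemma position_ell_tau:
  assumes "k < 2 ^ n" "t \<in> {0..1}"
  shows "position ell_tau (2 ^ n + k) t = gap_progress n k t"
  unfolding position_def
proof (rule circle_lift_unique)
  show "gap_progress n k 0 = 0"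
    using gap_bounds[OF assms(1)] by (intro gap_progress_before) auto
qed (use assms in \<open>auto simp: theta_ell_tau continuous_on_gap_progress\<close>)

text \<open>Circle \<open>2 ^ n + k\<close> is traversed once, during its gap. All gaps of circles with smaller index lie entirely
  to the left or to the right of the surrounding interval, so at that time each of them has been
  traversed completely or not at all, and \<open>v\<close> records which.\<close>

lemma crossings_ell_tau:
  assumes k: "k < 2 ^ n" and v0: "v 0 = 0"
    and v: "\<And>n' k'. k' < 2 ^ n' \<Longrightarrow> 2 ^ n' + k' < 2 ^ n + k \<Longrightarrow>
      v (2 ^ n' + k') = (if gap_hi n' k' \<le> cantor_left n k then 1 else 0)"
  shows "crossings ell_tau (2 ^ n + k) v = 1"
proof -
  have "gated ell_tau (2 ^ n + k) v t = cis (2 * pi * gap_progress n k t)" if t: "t \<in> {0..1}" for t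
  proof (cases "t \<in> {gap_lo n k..gap_hi n k}")
    case False
    then show ?thesis
      by (simp add: gated_def theta_ell_tau[OF k] cis_gap_progress_outside)
  next
    case True
    have "position ell_tau j t = v j" if j: "j < 2 ^ n + k" for j
    proof (cases "j = 0")
      case True
      have "position ell_tau 0 t = 0"
        unfolding position_def using t by (intro circle_lift_const) auto
      then show ?thesis
        using True v0 by simp
    next
      case False
      then have "j \<ge> 1"
        by simp
      then obtain n' k' where k': "k' < 2 ^ n'" "j = 2 ^ n' + k'"
        by (rule node_exists)
      have "n' < n \<or> (n' = n \<and> k' \<noteq> k)"
      proof (rule ccontr)
        assume n: "\<not> ?thesis"
        then have "n < n'"
          using j k' by auto
        then have "(2::nat) ^ Suc n \<le> 2 ^ n'"
          by (intro power_increasing) auto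
        then show False
          using j k' k by simp
      qed
      from gap_separated[OF this k'(1) k] show ?thesis
      proof
        assume le: "gap_hi n' k' \<le> cantor_left n k"
        then have "gap_hi n' k' \<le> t"
          using True gap_inside[of n k] by auto
        then show ?thesis
          using k' v[OF k'(1)] j le t by (simp add: position_ell_tau gap_progress_after)
      next
        assume ge: "cantor_left n k + 1 / 3 ^ n \<le> gap_lo n' k'"
        then have "t \<le> gap_lo n' k'"
          using True gap_inside[of n k] by auto
        moreover have "\<not> gap_hi n' k' \<le> cantor_left n k"
          using ge gap_inside[of n k] gap_lo_less_hi[of n k] gap_lo_less_hi[of n' k'] by linarith
        ultimately show ?thesis
          using k' v[OF k'(1)] j t by (simp add: position_ell_tau gap_progress_before)
      qed
    qed
    then show ?thesis
      by (simp add: gated_def theta_ell_tau[OF k])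
  qed
  then have "circle_lift (gated ell_tau (2 ^ n + k) v) 1 = gap_progress n k 1"
    using gap_bounds[OF k]
    by (intro circle_lift_unique) (auto simp: continuous_on_gap_progress gap_progress_before)
  then show ?thesis
    unfolding crossings_def using gap_bounds[OF k] by (simp add: gap_progress_after)
qed

text \<open>Every infinite branch of the tree of Cantor intervals determines a visited point: the indicator
  function of the circles whose gaps are to the left of the branch. Each node \<open>m\<close> of the branch is a
  crossing, because the gaps of the circles \<open>j < m\<close> are on the same side of the branch as of the gap
  of \<open>m\<close>. Given an enumeration \<open>e\<close> of the visited points, the branch \<open>K\<close> is chosen diagonally: at its
  \<open>n\<close>-th node it turns so that its point differs from \<open>e n\<close> in the coordinate of that node.\<close>

lemma uncountable_visited_ell_tau: "uncountable (visited ell_tau)"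
proof
  assume ctbl: "countable (visited ell_tau)"
  define e where "e = from_nat_into (visited ell_tau)"
  define K where "K = rec_nat 0 (\<lambda>n k. 2 * k + (if e n (2 ^ n + k) = 1 then 0 else 1))"
  have K_Suc: "K (Suc n) = 2 * K n + (if e n (2 ^ n + K n) = 1 then 0 else 1)" for n
    by (simp add: K_def)
  have K: "K n < 2 ^ n" for n
  proof (induction n)
    case (Suc n)
    then show ?case
      by (simp add: K_Suc)
  qed (simp add: K_def)
  have sub: "cantor_interval (Suc n) (K (Suc n)) \<subseteq> cantor_interval n (K n)" for n
    using cantor_interval_parent[of n "K (Suc n)"] by (simp add: K_Suc split: if_splits)
  have nested: "cantor_interval n' (K n') \<subseteq> cantor_interval n (K n)" if "n \<le> n'" for n n'
    using that by (induction n' rule: dec_induct) (use sub in blast)+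
  \<comment> \<open>the gap of \<open>j\<close> is compared with those intervals of the branch that belong to circles of larger index\<close>
  define v :: "nat \<Rightarrow> real" where
    "v j = (if \<exists>m k n. j = 2 ^ m + k \<and> k < 2 ^ m \<and> gap_hi m k \<le> cantor_left n (K n) \<and> j < 2 ^ n + K n
      then 1 else 0)" for j
  have v: "v (2 ^ m + k) = (if gap_hi m k \<le> cantor_left n (K n) then 1 else 0)"
    if k: "k < 2 ^ m" and lt: "2 ^ m + k < 2 ^ n + K n" for m k n
  proof (cases "gap_hi m k \<le> cantor_left n (K n)")
    case True
    then show ?thesis
      using k lt unfolding v_def by auto
  next
    case False
    have "m < n \<or> (m = n \<and> k \<noteq> K n)"
    proof (rule ccontr)
      assume n: "\<not> ?thesis"
      then have "n < m"
        using lt by auto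
      then have "(2::nat) ^ Suc n \<le> 2 ^ m"
        by (intro power_increasing) auto
      then show False
        using lt K[of n] by simp
    qed
    then have right: "cantor_left n (K n) + 1 / 3 ^ n \<le> gap_lo m k"
      using gap_separated[OF _ k K] False by blast
    have "\<not> gap_hi m k \<le> cantor_left n' (K n')" for n'
    proof
      assume left: "gap_hi m k \<le> cantor_left n' (K n')"
      let ?N = "max n n'"
      have "cantor_left ?N (K ?N) \<in> cantor_interval ?N (K ?N)"
        by (simp add: cantor_interval_def)
      then have "cantor_left ?N (K ?N) \<in> cantor_interval n (K n) \<inter> cantor_interval n' (K n')"
        using nested[of n ?N] nested[of n' ?N] by auto
      then show False
        using left right gap_lo_less_hi[of m k] by (auto simp: cantor_interval_def)
    qed
    then have "v (2 ^ m + k) = 0"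
      unfolding v_def using node_unique[OF k] by (metis (no_types, lifting))
    then show ?thesis
      using False by simp
  qed
  have v0: "v 0 = 0"
    by (simp add: v_def)
  have "crossings ell_tau (2 ^ n + K n) v = 1" for n
    by (rule crossings_ell_tau[OF K v0 v])
  then have "\<exists>m\<ge>N. crossings ell_tau m v \<noteq> 0" for N
    by (intro exI[of _ "2 ^ N + K N"]) (simp add: less_imp_le trans_le_add1 less_exp)
  then have "v \<in> visited ell_tau"
    by (simp add: frequent_def frequently_sequentially)
  then obtain i where i: "e i = v"
    unfolding e_def using from_nat_into_surj[OF ctbl] by blast
  \<comment> \<open>turning left leaves the gap of this node to the right of the branch, and conversely\<close>
  let ?m = "2 ^ i + K i"
  have "?m < 2 ^ Suc i + K (Suc i)"
    using K[of i] by simp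
  then have vi: "v ?m = (if gap_hi i (K i) \<le> cantor_left (Suc i) (K (Suc i)) then 1 else 0)"
    by (intro v K)
  show False
  proof (cases "v ?m = 1")
    case True
    then have "cantor_left (Suc i) (K (Suc i)) = cantor_left i (K i)"
      by (simp add: K_Suc i)
    then show False
      using True vi gap_inside[of i "K i"] gap_lo_less_hi[of i "K i"] by (auto split: if_splits)
  next
    case False
    then have "cantor_left (Suc i) (K (Suc i)) = gap_hi i (K i)"
      by (simp add: K_Suc i gap_hi_def)
    then show False
      using False vi by simp
  qed
qed

text \<open>Continuity of \<open>ell_tau\<close> comes for free: a class in the subgroup is the class of a loop, and only
  continuous paths are homotopic to it.\<close>

lemma c_tau_not_scattered: "c_tau \<notin> scattered_classes"
proof
  let ?r = "reversepath whisker"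
  let ?w = "whisker +++ ell_tau +++ ?r"
  assume "c_tau \<in> scattered_classes"
  then obtain q where q: "q \<in> based_loops earring_plus b0_plus" "countable (visited q)"
    "path_class earring_plus ?w = path_class earring_plus q"
    unfolding scattered_classes_def c_tau_def whisker_class_def by auto
  then have hom: "homotopic_paths earring_plus ?w q"
    using path_class_eq_iff by metis
  have "ell_tau 0 = b0" "ell_tau 1 = b0"
    using gap_bounds by (cases rule: ell_tau_cases[of 0]; force) (cases rule: ell_tau_cases[of 1]; use gap_bounds in force)
  then have ends: "pathstart ell_tau = b0" "pathfinish ell_tau = b0"
    by (auto simp: pathstart_def pathfinish_def)
  have "path ?w" "path_image ?w \<subseteq> earring_plus"
    using hom homotopic_paths_imp_path homotopic_paths_imp_subset by blast+
  then have tau: "anchored ell_tau"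
    using ends path_whisker(3) by (auto simp: anchored_def path_image_join)
  have r: "anchored ?r"
    by (intro anchored_reversepath anchored_whisker)
  have triv: "theta j (?r t) = 1" if "t \<in> {0..1}" for j t
    using that by (simp add: reversepath_def theta_whisker_path)
  have tr: "anchored (ell_tau +++ ?r)"
    using tau r ends path_whisker(3) by (intro anchored_join) auto
  have "crossings ?w m v = crossings ell_tau m v" for m v
  proof -
    have "crossings ?w m v = crossings (ell_tau +++ ?r) m v"
      using crossings_join(2)[OF anchored_whisker tr, of m v] ends path_whisker(3)
        crossings_trivial[OF theta_whisker_path] by simp
    also have "\<dots> = crossings ell_tau m v"
      using crossings_join(2)[OF tau r, of m v] ends path_whisker(3)
        crossings_trivial(2)[OF triv] by simp
    finally show ?thesis .
  qed
  then have "visited ell_tau = visited ?w"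
    by (simp add: frequent_def)
  also have "\<dots> = visited q"
    using tau r ends path_whisker(3)
    by (intro visited_homotopic[OF hom] anchored_join anchored_whisker) auto
  finally show False
    using q(2) uncountable_visited_ell_tau by simp
qed

theorem corollary3p15:
  shows "c_tau \<notin> closed_closure earring_plus b0_plus C_fin c_inf earring_plus b0_plus C_fin"
  using closed_scattered_classes C_fin_scattered c_tau_not_scattered
  unfolding closed_closure_def by blast

end
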